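(* Let $b\geq 2$ be an even integer, and let $G$ be a connected graph of even order $n$ with minimum degree $\delta\geq 1$, where $$n\geq\max\left\{\frac{b^{2}\delta+2b\delta-\delta-1}{b-1},\ \frac{b^{2}\delta^{2}+(4b^{2}+5b)\delta+b^{2}+4b+1}{6b}\right\}.$$ If $$e(G)\geq e\bigl(K_{\delta}\vee(K_{n-(b+1)\delta}\cup b\delta K_1)\bigr),$$ then $G$ has an $H_b$-factor, unless $G=K_{\delta}\vee(K_{n-(b+1)\delta}\cup b\delta K_1)$.
   Context: All graphs are finite, undirected and simple. For a graph $G$, the order is $|V(G)|$, the size is $e(G)=|E(G)|$, and $d_G(v)$ denotes the degree of the vertex $v$ in $G$; the minimum degree of $G$ is $\delta=\delta(G)$. $K_m$ is the complete graph on $m$ vertices. For vertex-disjoint graphs $G_1,G_2$, $G_1\cup G_2$ is their (disjoint) union, and the join $G_1\vee G_2$ is obtained from $G_1\cup G_2$ by adding every possible edge between $V(G_1)$ and $V(G_2)$. $mK_1$ denotes the disjoint union of $m$ copies of $K_1$. Equality of graphs means equality up to isomorphism. For an even integer $b\geq 2$, an $H_b$-factor of $G$ is a spanning subgraph $F$ of $G$ such that $d_F(v)\in\{1,3,5,\ldots,b-1,b\}$ for every $v\in V(G)$ (that is, each $d_F(v)$ is either an odd integer between $1$ and $b-1$ or equal to $b$). *)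

theory Defs
  imports
    Complex_Main
    "Graph_Theory.Pair_Digraph"
    "Graph_Theory.Digraph_Component"
    "Graph_Theory.Digraph_Isomorphism"
    "Graph_Theory.Kuratowski"
begin

text \<open>
  A finite simple undirected graph is a \<^locale>\<open>pair_graph\<close>: finite vertex set, and an
  irreflexive symmetric arc relation in which an undirected edge $uv$ is the pair of arcs
  $(u,v)$, $(v,u)$. Hence the degree of $v$ is \<^const>\<open>out_degree\<close>, whereas the size must not
  be read off from \<^const>\<open>parcs\<close>, which counts every edge twice.
\<close>

definition uedges :: "'a pair_pre_digraph \<Rightarrow> 'a set set" where
  "uedges G = {{u, v} | u v. (u, v) \<in> parcs G}"

definition graph_size :: "'a pair_pre_digraph \<Rightarrow> nat" where
  "graph_size G = card (uedges G)"

definition graph_order :: "'a pair_pre_digraph \<Rightarrow> nat" where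
  "graph_order G = card (pverts G)"

definition min_degree :: "'a pair_pre_digraph \<Rightarrow> nat" where
  "min_degree G = Min (out_degree G ` pverts G)"

definition complete_graph :: "nat \<Rightarrow> nat pair_pre_digraph" where
  "complete_graph m = \<lparr> pverts = {..<m}, parcs = {(u, v). u < m \<and> v < m \<and> u \<noteq> v} \<rparr>"

definition disjoint_union ::
    "'a pair_pre_digraph \<Rightarrow> 'b pair_pre_digraph \<Rightarrow> ('a + 'b) pair_pre_digraph" where
  "disjoint_union G H = \<lparr>
     pverts = pverts G <+> pverts H,
     parcs = map_prod Inl Inl ` parcs G \<union> map_prod Inr Inr ` parcs H \<rparr>"

definition graph_join ::
    "'a pair_pre_digraph \<Rightarrow> 'b pair_pre_digraph \<Rightarrow> ('a + 'b) pair_pre_digraph" where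
  "graph_join G H = \<lparr>
     pverts = pverts (disjoint_union G H),
     parcs = parcs (disjoint_union G H)
       \<union> (Inl ` pverts G) \<times> (Inr ` pverts H) \<union> (Inr ` pverts H) \<times> (Inl ` pverts G) \<rparr>"

definition copies :: "nat \<Rightarrow> 'a pair_pre_digraph \<Rightarrow> (nat \<times> 'a) pair_pre_digraph" where
  "copies m G = \<lparr>
     pverts = {..<m} \<times> pverts G,
     parcs = {((i, u), (i, v)) | i u v. i < m \<and> (u, v) \<in> parcs G} \<rparr>"

text \<open>
  The graph $K_\delta \vee (K_{n-(b+1)\delta} \cup b\delta K_1)$; the subtraction is the
  truncated one on natural numbers, so this is meaningful only for $n \ge (b+1)\delta$.
\<close>

definition extremal_graph ::
    "nat \<Rightarrow> nat \<Rightarrow> nat \<Rightarrow> (nat + nat + nat \<times> nat) pair_pre_digraph" where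
  "extremal_graph b d n =
     graph_join (complete_graph d)
       (disjoint_union (complete_graph (n - (b + 1) * d)) (copies (b * d) (complete_graph 1)))"

text \<open>
  \<^const>\<open>spanning\<close> alone allows the subgraph to contain only one of the two arcs of an edge;
  requiring \<^locale>\<open>pair_graph\<close> makes it a subgraph in the undirected sense.
\<close>

definition is_H_factor :: "nat \<Rightarrow> 'a pair_pre_digraph \<Rightarrow> 'a pair_pre_digraph \<Rightarrow> bool" where
  "is_H_factor b F G \<longleftrightarrow>
     pair_graph F \<and> spanning F G \<and>
     (\<forall>v \<in> pverts G. out_degree F v \<in> {k \<in> {1..b - 1}. odd k} \<union> {b})"

definition has_H_factor :: "nat \<Rightarrow> 'a pair_pre_digraph \<Rightarrow> bool" where
  "has_H_factor b G \<longleftrightarrow> (\<exists>F. is_H_factor b F G)"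

abbreviation graph_iso :: "'a pair_pre_digraph \<Rightarrow> 'b pair_pre_digraph \<Rightarrow> bool" where
  "graph_iso G H \<equiv> digraph_iso (with_proj G) (with_proj H)"

text \<open>Consistency of the constructions with the library notions.\<close>

lemma complete_digraph_complete_graph: "complete_digraph m (with_proj (complete_graph m))"
  by (auto simp: complete_digraph_pair_def complete_graph_def)

lemma pair_graph_complete_graph: "pair_graph (complete_graph m)"
  using complete_digraph_complete_graph by (rule pair_graphI_complete)

lemma pair_graph_iff:
  "pair_graph G \<longleftrightarrow> finite (pverts G) \<and> parcs G \<subseteq> pverts G \<times> pverts G \<and>
     sym (parcs G) \<and> irrefl (parcs G)"
proof
  assume "pair_graph G"
  then interpret pair_graph G .
  show "finite (pverts G) \<and> parcs G \<subseteq> pverts G \<times> pverts G \<and> sym (parcs G) \<and> irrefl (parcs G)"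
    using pair_finite_verts pair_sym_arcs pair_no_loops arc_fst_in_verts arc_snd_in_verts
    by (fastforce simp: symmetric_def irrefl_def)
next
  assume *: "finite (pverts G) \<and> parcs G \<subseteq> pverts G \<times> pverts G \<and> sym (parcs G) \<and> irrefl (parcs G)"
  then have "finite (parcs G)"
    using finite_subset by blast
  with * show "pair_graph G"
    by unfold_locales (auto simp: symmetric_def irrefl_def)
qed

lemma pair_graph_disjoint_union:
  assumes "pair_graph G" "pair_graph H"
  shows "pair_graph (disjoint_union G H)"
  using assms by (fastforce simp: pair_graph_iff disjoint_union_def sym_def irrefl_def)

lemma pair_graph_graph_join:
  assumes "pair_graph G" "pair_graph H"
  shows "pair_graph (graph_join G H)"
  using assms
  by (fastforce simp: pair_graph_iff graph_join_def sym_def irrefl_def disjoint_union_def)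

lemma pair_graph_copies:
  assumes "pair_graph G"
  shows "pair_graph (copies m G)"
  using assms by (auto simp: pair_graph_iff copies_def sym_def irrefl_def)

lemma pair_graph_extremal_graph: "pair_graph (extremal_graph b d n)"
  unfolding extremal_graph_def
  by (intro pair_graph_graph_join pair_graph_disjoint_union pair_graph_copies
      pair_graph_complete_graph)

lemma graph_order_extremal_graph:
  assumes "(b + 1) * d \<le> n"
  shows "graph_order (extremal_graph b d n) = n"
  using assms
  by (simp add: graph_order_def extremal_graph_def graph_join_def disjoint_union_def copies_def
      complete_graph_def card_Plus)

lemma graph_iso_iff:
  assumes "pair_graph G"
  shows "graph_iso G H \<longleftrightarrow>
    (\<exists>f. bij_betw f (pverts G) (pverts H) \<and> parcs H = map_prod f f ` parcs G)"
proof
  interpret pair_graph G by fact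
  assume "graph_iso G H"
  then obtain h where h: "digraph_isomorphism h" and H: "with_proj H = app_iso h (with_proj G)"
    by (auto simp: digraph_iso_def)
  from arg_cong[OF H, of verts] arg_cong[OF H, of arcs]
    arg_cong[OF H, of tail] arg_cong[OF H, of head]
  have eqs: "pverts H = iso_verts h ` pverts G" "parcs H = iso_arcs h ` parcs G"
    "iso_tail h = fst" "iso_head h = snd"
    by simp_all
  have "iso_arcs h a = map_prod (iso_verts h) (iso_verts h) a" if "a \<in> parcs G" for a
    using h that eqs by (auto simp: digraph_isomorphism_def prod_eq_iff)
  then have "parcs H = map_prod (iso_verts h) (iso_verts h) ` parcs G"
    using eqs by (auto simp: image_iff)
  moreover have "bij_betw (iso_verts h) (pverts G) (pverts H)"
    using h eqs by (auto simp: digraph_isomorphism_def bij_betw_def)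
  ultimately show "\<exists>f. bij_betw f (pverts G) (pverts H) \<and> parcs H = map_prod f f ` parcs G"
    by blast
next
  interpret pair_graph G by fact
  assume "\<exists>f. bij_betw f (pverts G) (pverts H) \<and> parcs H = map_prod f f ` parcs G"
  then obtain f where f: "bij_betw f (pverts G) (pverts H)" "parcs H = map_prod f f ` parcs G"
    by blast
  define h where "h = \<lparr> iso_verts = f, iso_arcs = map_prod f f, iso_head = snd, iso_tail = fst \<rparr>"
  have inj: "inj_on f (pverts G)" and img: "pverts H = f ` pverts G"
    using f by (auto simp: bij_betw_def)
  have "inj_on (map_prod f f) (parcs G)"
    by (rule inj_on_subset[OF map_prod_inj_on[OF inj inj]]) (auto dest: wellformed')
  with inj have "digraph_isomorphism h"
    by (auto simp: digraph_isomorphism_def h_def wf_digraph)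
  moreover have "with_proj H = app_iso h (with_proj G)"
    by (simp add: app_iso_def h_def with_proj_def img f)
  ultimately show "graph_iso G H"
    by (auto simp: digraph_iso_def)
qed

end

theory Submission
  imports Defs
begin

text \<open>
  A graph of even order in which deleting any vertex set $S$ leaves at most $b|S|$ odd components
  has an $H_b$-factor. To see this, choose $S$ maximizing the number of odd components of $G - S$
  minus $(b-1)|S|$, and maximal among such sets. The maximality turns each odd component $C$ into a
  critical one: for every $v \in C$ there is a subgraph of $C$ with odd degrees at most $b-1$, except
  that $v$ has even degree below $b - 1$. The extremal choice also gives the lower Hall condition, and the
  hypothesis the upper one, for attaching each odd component by one edge to a neighbour in $S$ so
  that each vertex of $S$ receives $b-1$ or $b$ edges. The subgraphs inside the components come from
  a parity factor theorem proved by the same decomposition.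

  If $G$ has no $H_b$-factor, then some $S \neq \emptyset$ leaves at least $b|S|+1$ components, each
  of order at least $\delta + 1 - |S|$. By convexity the number of edges is largest when all components
  but one have minimum order, and this maximum is attained only for $|S| = \delta$ and the extremal graph.
\<close>

section \<open>Components\<close>

text \<open>The edge that attaches a component to \<open>S\<close> spends one unit of the degree
  allowed at its end in the component, so constant degree bounds do not survive the passage to
  components. The factor theorems are therefore stated for an arbitrary bound \<open>f\<close> on
  the vertices, and a component counts as odd when its total weight under \<open>f\<close> is odd;
  for the constant odd bound \<open>b - 1\<close> this is the usual parity of the order. The lost
  unit is affordable because of parity: the number of odd components is congruent to the weight of
  the remaining graph, so a strict inequality that maximality provides is a gap of at least two. The
  even degree \<open>b\<close> arises only on \<open>S\<close>, where the degree of a vertex is the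
  number of components assigned to it and no parity has to be kept. This is why capacities on
  \<open>S\<close> run up to \<open>b\<close> while the maximized quantity is weighted with
  \<open>b - 1\<close>.\<close>

definition detached :: "('a \<times> 'a) set \<Rightarrow> 'a set \<Rightarrow> 'a set \<Rightarrow> bool" where
  "detached E W D \<longleftrightarrow> D \<subseteq> W \<and> (\<forall>x\<in>D. \<forall>y\<in>W - D. (x, y) \<notin> E)"

text \<open>The connected components are the atoms of the Boolean algebra of detached sets.\<close>

definition comps :: "('a \<times> 'a) set \<Rightarrow> 'a set \<Rightarrow> 'a set set" where
  "comps E W = {C. detached E W C \<and> C \<noteq> {} \<and> (\<forall>D\<subseteq>C. detached E W D \<and> D \<noteq> {} \<longrightarrow> D = C)}"

definition odd_comps :: "('a \<times> 'a) set \<Rightarrow> ('a \<Rightarrow> nat) \<Rightarrow> 'a set \<Rightarrow> 'a set set" where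
  "odd_comps E f W = {C \<in> comps E W. odd (sum f C)}"

definition deg :: "('a \<times> 'a) set \<Rightarrow> 'a \<Rightarrow> nat" where
  "deg F v = card {w. (v, w) \<in> F}"

text \<open>Lovasz's parity factor, with the lower bounds 0 and 1 left implicit in the parity of
  \<open>f v\<close>.\<close>

definition parity_factor :: "('a \<times> 'a) set \<Rightarrow> 'a set \<Rightarrow> ('a \<Rightarrow> nat) \<Rightarrow> ('a \<times> 'a) set \<Rightarrow> bool" where
  "parity_factor E V f F \<longleftrightarrow> F \<subseteq> E \<and> F \<subseteq> V \<times> V \<and> sym F \<and>
     (\<forall>v\<in>V. deg F v \<le> f v \<and> even (deg F v + f v))"

lemma detached_Diff:
  assumes "sym E" "detached E W D"
  shows "detached E W (W - D)"
  using assms unfolding detached_def sym_def by blast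

lemma detached_Int:
  assumes "detached E W C" "detached E W D"
  shows "detached E W (C \<inter> D)"
  using assms by (auto simp: detached_def)

lemma comps_subset: "C \<in> comps E W \<Longrightarrow> C \<subseteq> W"
  by (simp add: comps_def detached_def)

lemma comps_nonempty: "C \<in> comps E W \<Longrightarrow> C \<noteq> {}"
  by (simp add: comps_def)

lemma comps_imp_detached: "C \<in> comps E W \<Longrightarrow> detached E W C"
  by (simp add: comps_def)

lemma finite_comps: "finite W \<Longrightarrow> finite (comps E W)"
  by (rule finite_subset[of _ "Pow W"]) (auto dest: comps_subset)

lemma finite_odd_comps: "finite W \<Longrightarrow> finite (odd_comps E f W)"
  by (simp add: odd_comps_def finite_comps)

lemma comps_disjoint:
  assumes "C \<in> comps E W" "D \<in> comps E W" "C \<inter> D \<noteq> {}"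
  shows "C = D"
proof -
  have "detached E W (C \<inter> D)"
    using assms comps_imp_detached detached_Int by metis
  then have "C \<inter> D = C" "C \<inter> D = D"
    using assms unfolding comps_def by auto
  then show ?thesis by simp
qed

text \<open>A detached set of least cardinality through \<open>x\<close> is an atom: a nonempty
  detached part missing \<open>x\<close> could be cut off, leaving a smaller detached set through
  \<open>x\<close>.\<close>

lemma Union_comps:
  assumes "sym E" "finite W"
  shows "\<Union> (comps E W) = W"
proof
  show "\<Union> (comps E W) \<subseteq> W" by (auto dest: comps_subset)
  show "W \<subseteq> \<Union> (comps E W)"
  proof
    fix x assume x: "x \<in> W"
    define P where "P C \<longleftrightarrow> detached E W C \<and> x \<in> C" for C
    have "P W" using x by (auto simp: P_def detached_def)
    then obtain C where C: "P C" and min: "\<And>D. P D \<Longrightarrow> card C \<le> card D"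
      using ex_has_least_nat[of P W card] by blast
    have fin: "finite C" using C assms finite_subset unfolding P_def detached_def by blast
    have "D = C" if D: "D \<subseteq> C" "detached E W D" "D \<noteq> {}" for D
    proof (cases "x \<in> D")
      case True
      then show ?thesis
        using min[of D] D fin by (simp add: P_def card_subset_eq card_mono le_antisym)
    next
      case False
      have "detached E W (C \<inter> (W - D))"
        using C D detached_Int detached_Diff assms unfolding P_def by blast
      then have "P (C \<inter> (W - D))"
        using False C x by (auto simp: P_def)
      from min[OF this] have "C \<inter> (W - D) = C"
        using fin by (metis Int_lower1 card_seteq)
      then show ?thesis using D by blast
    qed
    then have "C \<in> comps E W"
      using C by (auto simp: comps_def P_def)
    then show "x \<in> \<Union> (comps E W)" using C by (auto simp: P_def)
  qed
qed

lemma comps_detached: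
  assumes "detached E W X"
  shows "comps E X = {C \<in> comps E W. C \<subseteq> X}"
proof -
  have iff: "detached E X C \<longleftrightarrow> C \<subseteq> X \<and> detached E W C" for C
    using assms unfolding detached_def by blast
  show ?thesis by (auto simp: comps_def iff)
qed

text \<open>An atom meets a detached set in nothing or in all of itself.\<close>

lemma comps_split:
  assumes "sym E" "detached E W D"
  shows "comps E W = comps E D \<union> comps E (W - D)"
proof -
  have D': "detached E W (W - D)" using assms by (rule detached_Diff)
  have "C \<subseteq> D \<or> C \<subseteq> W - D" if C: "C \<in> comps E W" for C
  proof -
    have "detached E W (C \<inter> D)" using detached_Int[OF comps_imp_detached[OF C] assms(2)] .
    then have "C \<inter> D = {} \<or> C \<inter> D = C" using C by (auto simp: comps_def)
    then show ?thesis using comps_subset[OF C] by blast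
  qed
  then show ?thesis
    unfolding comps_detached[OF assms(2)] comps_detached[OF D'] by blast
qed

lemma comps_self:
  assumes "C \<in> comps E W"
  shows "comps E C = {C}"
proof -
  have "D = C" if "D \<in> comps E W" "D \<subseteq> C" for D
    using comps_disjoint[OF that(1) assms] comps_nonempty[OF that(1)] that(2) by blast
  then show ?thesis
    unfolding comps_detached[OF comps_imp_detached[OF assms]] using assms by blast
qed

text \<open>Deleted vertices without a neighbour in \<open>C\<close> can be put back without
  disturbing \<open>C\<close>. This is what relates Hall's conditions to smaller separators.\<close>

lemma comps_enlarge:
  assumes "sym E" "C \<in> comps E W" "W \<subseteq> W'" "\<And>x y. x \<in> C \<Longrightarrow> y \<in> W' - W \<Longrightarrow> (x, y) \<notin> E"
  shows "C \<in> comps E W'"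
proof -
  have d: "detached E W' C"
    using assms comps_subset[OF assms(2)] comps_imp_detached[OF assms(2)] unfolding detached_def by blast
  have "comps E C = {C}" using assms comps_self by metis
  then show ?thesis using comps_split[OF assms(1) d] by blast
qed

text \<open>Deleting \<open>R\<close> affects only the component that contains it; this localizes
  the global extremality of \<open>S\<close> to a single component.\<close>

lemma odd_comps_Diff:
  assumes "sym E" "finite W" "C \<in> comps E W" "R \<subseteq> C"
  shows "card (odd_comps E f (W - R)) = card (odd_comps E f (C - R)) + card (odd_comps E f (W - C))"
proof -
  have "detached E (W - R) (C - R)"
    using comps_imp_detached[OF assms(3)] by (auto simp: detached_def)
  moreover have "W - R - (C - R) = W - C" using assms by blast
  ultimately have "comps E (W - R) = comps E (C - R) \<union> comps E (W - C)"
    using comps_split[OF assms(1)] by metis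
  then have "odd_comps E f (W - R) = odd_comps E f (C - R) \<union> odd_comps E f (W - C)"
    by (auto simp: odd_comps_def)
  moreover have "odd_comps E f (C - R) \<inter> odd_comps E f (W - C) = {}"
    unfolding odd_comps_def using comps_subset comps_nonempty by blast
  moreover have "finite C" using comps_subset[OF assms(3)] assms(2) finite_subset by metis
  ultimately show ?thesis
    using assms by (simp add: card_Un_disjoint finite_odd_comps)
qed

lemma card_odd_comps_self:
  assumes "C \<in> comps E W"
  shows "card (odd_comps E f C) = (if odd (sum f C) then 1 else 0)"
proof -
  have "odd_comps E f C = {D. D = C \<and> odd (sum f C)}"
    using comps_self[OF assms] by (auto simp: odd_comps_def)
  then show ?thesis by auto
qed

lemma sum_comps:
  assumes "sym E" "finite W"
  shows "sum f W = (\<Sum>C\<in>comps E W. sum f C)"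
proof -
  have "\<forall>C\<in>comps E W. \<forall>D\<in>comps E W. C \<noteq> D \<longrightarrow> C \<inter> D = {}"
    using comps_disjoint by metis
  then have "sum f (\<Union> (comps E W)) = (\<Sum>C\<in>comps E W. sum f C)"
    using finite_subset[OF comps_subset assms(2)] by (subst sum.Union_disjoint) auto
  then show ?thesis using Union_comps[OF assms] by simp
qed

text \<open>Every upgrade of a strict inequality to a gap of two rests on this congruence.\<close>

lemma odd_comps_parity:
  assumes "sym E" "finite W"
  shows "even (card (odd_comps E f W) + sum f W)"
  using sum_comps[OF assms, of f] even_sum_iff[OF finite_comps[OF assms(2), of E], of "sum f"]
  by (simp add: odd_comps_def)

section \<open>Hall's theorem with capacities\<close>

text \<open>Rado's argument: as long as some \<open>c\<close> has two neighbours, one of the two edges can be dropped.\<close>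

lemma capacitated_hall:
  fixes u :: "'s \<Rightarrow> nat"
  assumes "finite Q" "finite S" "\<And>c. c \<in> Q \<Longrightarrow> N c \<subseteq> S"
    and "\<And>A. A \<subseteq> Q \<Longrightarrow> card A \<le> sum u (\<Union> (N ` A))"
  shows "\<exists>\<phi>. (\<forall>c\<in>Q. \<phi> c \<in> N c) \<and> (\<forall>s\<in>S. card {c \<in> Q. \<phi> c = s} \<le> u s)"
  using assms(3,4)
proof (induction "\<Sum>c\<in>Q. card (N c)" arbitrary: N rule: less_induct)
  case less
  note sub = less.prems(1) and hall = less.prems(2)
  have finN: "finite (N c)" if "c \<in> Q" for c
    using sub[OF that] assms(2) finite_subset by blast
  show ?case
  proof (cases "\<exists>c\<in>Q. \<exists>s\<in>N c. \<exists>t\<in>N c. s \<noteq> t")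
    case False
    have ne: "N c \<noteq> {}" if "c \<in> Q" for c
      using hall[of "{c}"] that by auto
    define \<phi> where "\<phi> c = (SOME s. s \<in> N c)" for c
    have \<phi>: "\<phi> c \<in> N c" if "c \<in> Q" for c
      using ne[OF that] unfolding \<phi>_def by (simp add: some_in_eq)
    have single: "N c = {\<phi> c}" if "c \<in> Q" for c
      using False \<phi> that by blast
    have "card {c \<in> Q. \<phi> c = s} \<le> u s" for s
    proof -
      have "card {c \<in> Q. \<phi> c = s} \<le> sum u (\<Union> (N ` {c \<in> Q. \<phi> c = s}))"
        by (rule hall) auto
      also have "\<dots> \<le> sum u {s}"
        by (rule sum_mono2) (auto simp: single)
      finally show ?thesis by simp
    qed
    then show ?thesis using \<phi> by blast
  next
    case True
    then obtain c s t where c: "c \<in> Q" "s \<in> N c" "t \<in> N c" "s \<noteq> t" by blast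
    \<comment> \<open>The strict inequality \<open>h\<close> is Hall's condition for
      \<open>insert c A\<close> once \<open>r\<close> is dropped from \<open>N c\<close>; sets
      without \<open>c\<close> do not notice the change.\<close>
    have step: ?thesis
      if r: "r \<in> N c" and h: "\<And>A. A \<subseteq> Q - {c} \<Longrightarrow> card A < sum u (\<Union> (N ` A) \<union> (N c - {r}))" for r
    proof -
      let ?N = "N(c := N c - {r})"
      have *: "card A \<le> sum u (\<Union> (?N ` A))" if A: "A \<subseteq> Q" for A
      proof (cases "c \<in> A")
        case True
        have "finite A" using A assms(1) finite_subset by blast
        then have "card A = Suc (card (A - {c}))" using True card_Suc_Diff1 by metis
        also have "\<dots> \<le> sum u (\<Union> (N ` (A - {c})) \<union> (N c - {r}))"
          using h[of "A - {c}"] A by (simp add: Suc_le_eq subset_iff)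
        also have "\<Union> (N ` (A - {c})) \<union> (N c - {r}) = \<Union> (?N ` A)"
          using True by (auto split: if_splits)
        finally show ?thesis .
      next
        case False
        then have "?N ` A = N ` A" by (auto simp: image_iff)
        then show ?thesis using hall[OF A] by simp
      qed
      have "(\<Sum>c\<in>Q. card (?N c)) < (\<Sum>c\<in>Q. card (N c))"
        using assms(1) c(1) card_Diff1_less[OF finN[OF c(1)] r]
        by (intro sum_strict_mono_ex1) (auto intro!: card_mono bexI[of _ c] simp: finN)
      moreover have "?N c' \<subseteq> S" if "c' \<in> Q" for c'
        using sub[OF that] by auto
      ultimately have "\<exists>\<phi>. (\<forall>c'\<in>Q. \<phi> c' \<in> ?N c') \<and> (\<forall>s\<in>S. card {c \<in> Q. \<phi> c = s} \<le> u s)"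
        using less.hyps[of ?N] * by presburger
      then obtain \<phi> where "\<forall>c'\<in>Q. \<phi> c' \<in> ?N c'" "\<forall>s\<in>S. card {c \<in> Q. \<phi> c = s} \<le> u s"
        by blast
      moreover have "?N c' \<subseteq> N c'" for c' by auto
      ultimately show ?thesis by blast
    qed
    show ?thesis
    proof (rule ccontr)
      assume contr: "\<not> ?thesis"
      obtain A where A: "A \<subseteq> Q - {c}" "sum u (\<Union> (N ` A) \<union> (N c - {s})) \<le> card A"
        using step[OF c(2)] contr not_less by blast
      obtain B where B: "B \<subseteq> Q - {c}" "sum u (\<Union> (N ` B) \<union> (N c - {t})) \<le> card B"
        using step[OF c(3)] contr not_less by blast
      let ?X = "\<Union> (N ` A) \<union> (N c - {s})" and ?Y = "\<Union> (N ` B) \<union> (N c - {t})"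
      have fin: "finite A" "finite B" using A B assms(1) finite_subset by blast+
      have XS: "?X \<subseteq> S" "?Y \<subseteq> S" using A B sub c by blast+
      then have finX: "finite ?X" "finite ?Y" using assms(2) finite_subset by blast+
      have "Suc (card (A \<union> B)) = card (insert c (A \<union> B))"
        using A B fin by (subst card_insert_disjoint) auto
      also have "\<dots> \<le> sum u (\<Union> (N ` insert c (A \<union> B)))"
        using A B c by (intro hall) auto
      also have "\<dots> \<le> sum u (?X \<union> ?Y)"
        using finX c by (intro sum_mono2) auto
      finally have 1: "Suc (card (A \<union> B)) \<le> sum u (?X \<union> ?Y)" .
      have "card (A \<inter> B) \<le> sum u (\<Union> (N ` (A \<inter> B)))"
        using A by (intro hall) auto
      also have "\<dots> \<le> sum u (?X \<inter> ?Y)"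
        using finX by (intro sum_mono2) auto
      finally have 2: "card (A \<inter> B) \<le> sum u (?X \<inter> ?Y)" .
      show False
        using 1 2 A(2) B(2) sum.union_inter[OF finX, of u] card_Un_Int[OF fin] by linarith
    qed
  qed
qed

text \<open>
  Uncrossing: if $u(s)$ cannot be lowered and $l(s)$ cannot be raised, the two tight sets
  that block this force $u \le l$ on a set containing $s$.
\<close>

lemma capacitated_hall_bounds:
  fixes l u :: "'s \<Rightarrow> nat"
  assumes "finite Q" "finite S" "\<And>c. c \<in> Q \<Longrightarrow> N c \<subseteq> S"
    and "\<And>s. s \<in> S \<Longrightarrow> l s \<le> u s"
    and "\<And>A. A \<subseteq> Q \<Longrightarrow> card A \<le> sum u (\<Union> (N ` A))"
    and "\<And>X. X \<subseteq> S \<Longrightarrow> sum l X \<le> card {c \<in> Q. N c \<inter> X \<noteq> {}}"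
  shows "\<exists>\<phi>. (\<forall>c\<in>Q. \<phi> c \<in> N c) \<and>
    (\<forall>s\<in>S. l s \<le> card {c \<in> Q. \<phi> c = s} \<and> card {c \<in> Q. \<phi> c = s} \<le> u s)"
  using assms(4-6)
proof (induction "\<Sum>s\<in>S. u s - l s" arbitrary: l u rule: less_induct)
  case less
  note lu = less.prems(1) and up = less.prems(2) and lo = less.prems(3)
  show ?case
  proof (cases "\<exists>s\<in>S. l s < u s")
    case False
    then have eq: "l s = u s" if "s \<in> S" for s using lu that by force
    obtain \<phi> where \<phi>: "\<And>c. c \<in> Q \<Longrightarrow> \<phi> c \<in> N c" "\<And>s. s \<in> S \<Longrightarrow> card {c \<in> Q. \<phi> c = s} \<le> u s"
      using capacitated_hall[of Q S N u, OF assms(1-3) up] by blast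
    have "card Q = (\<Sum>s\<in>S. card {c \<in> Q. \<phi> c = s})"
    proof -
      have "Q = (\<Union>s\<in>S. {c \<in> Q. \<phi> c = s})" using \<phi>(1) assms(3) by blast
      then have "card Q = card (\<Union>s\<in>S. {c \<in> Q. \<phi> c = s})" by simp
      also have "\<dots> = (\<Sum>s\<in>S. card {c \<in> Q. \<phi> c = s})"
        using assms(1,2) by (intro card_UN_disjoint) auto
      finally show ?thesis .
    qed
    moreover have "sum u S \<le> card Q"
    proof -
      have "sum u S = sum l S" using eq by simp
      also have "\<dots> \<le> card {c \<in> Q. N c \<inter> S \<noteq> {}}" by (rule lo) simp
      also have "\<dots> \<le> card Q" using assms(1) by (intro card_mono) auto
      finally show ?thesis .
    qed
    ultimately have tot: "sum u S \<le> (\<Sum>s\<in>S. card {c \<in> Q. \<phi> c = s})" by simp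
    have "card {c \<in> Q. \<phi> c = s} = u s" if "s \<in> S" for s
    proof (rule ccontr)
      assume "card {c \<in> Q. \<phi> c = s} \<noteq> u s"
      then have "\<exists>s\<in>S. card {c \<in> Q. \<phi> c = s} < u s"
        using \<phi>(2) that le_neq_implies_less by blast
      then have "(\<Sum>s\<in>S. card {c \<in> Q. \<phi> c = s}) < sum u S"
        using \<phi>(2) assms(2) by (intro sum_strict_mono_ex1) blast+
      then show False using tot by simp
    qed
    then show ?thesis using \<phi>(1) eq by (intro exI[of _ \<phi>]) simp
  next
    case True
    then obtain s where s: "s \<in> S" "l s < u s" by blast
    have dec: "(\<Sum>x\<in>S. u' x - l' x) < (\<Sum>x\<in>S. u x - l x)"
      if "u' = u(s := u s - 1) \<and> l' = l \<or> u' = u \<and> l' = l(s := Suc (l s))" for u' l'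
      using that s assms(2) by (intro sum_strict_mono_ex1) (auto intro!: bexI[of _ s])
    show ?thesis
    proof (rule ccontr)
      assume contr: "\<not> ?thesis"
      have fu: "sum (u(s := u s - 1)) Y = sum u Y - (if s \<in> Y then 1 else 0)" if "finite Y" for Y
        using that s by (auto simp: sum.remove[of Y s] intro!: sum.cong)
      have fl: "sum (l(s := Suc (l s))) Y = sum l Y + (if s \<in> Y then 1 else 0)" if "finite Y" for Y
        using that s by (auto simp: sum.remove[of Y s] intro!: sum.cong)
      have finN: "finite (\<Union> (N ` A))" if "A \<subseteq> Q" for A
        using that assms(2,3) by (meson UN_least finite_subset subsetD)
      have "\<not> (\<forall>A\<subseteq>Q. card A \<le> sum (u(s := u s - 1)) (\<Union> (N ` A)))"
      proof
        assume *: "\<forall>A\<subseteq>Q. card A \<le> sum (u(s := u s - 1)) (\<Union> (N ` A))"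
        have "l x \<le> (u(s := u s - 1)) x" if "x \<in> S" for x using lu[OF that] s by auto
        from less.hyps[OF dec this _ lo] * obtain \<phi> where \<phi>: "\<forall>c\<in>Q. \<phi> c \<in> N c" "\<forall>x\<in>S. l x \<le> card {c \<in> Q. \<phi> c = x} \<and>
           card {c \<in> Q. \<phi> c = x} \<le> (u(s := u s - 1)) x" by blast
        have "(u(s := u s - 1)) x \<le> u x" for x by simp
        then show False using \<phi> contr le_trans by blast
      qed
      then obtain A where A: "A \<subseteq> Q" "card A > sum (u(s := u s - 1)) (\<Union> (N ` A))"
        using not_less by blast
      have sA: "s \<in> \<Union> (N ` A)" "sum u (\<Union> (N ` A)) \<le> card A"
        using A(2) up[OF A(1)] fu[OF finN[OF A(1)]] by (auto split: if_splits)
      have "\<not> (\<forall>X\<subseteq>S. sum (l(s := Suc (l s))) X \<le> card {c \<in> Q. N c \<inter> X \<noteq> {}})"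
      proof
        assume *: "\<forall>X\<subseteq>S. sum (l(s := Suc (l s))) X \<le> card {c \<in> Q. N c \<inter> X \<noteq> {}}"
        have "(l(s := Suc (l s))) x \<le> u x" if "x \<in> S" for x using lu[OF that] s by auto
        from less.hyps[OF dec this up] * obtain \<phi> where \<phi>: "\<forall>c\<in>Q. \<phi> c \<in> N c" "\<forall>x\<in>S. (l(s := Suc (l s))) x \<le> card {c \<in> Q. \<phi> c = x} \<and>
           card {c \<in> Q. \<phi> c = x} \<le> u x" by blast
        have "l x \<le> (l(s := Suc (l s))) x" for x by simp
        then show False using \<phi> contr le_trans by blast
      qed
      then obtain X where X: "X \<subseteq> S" "sum (l(s := Suc (l s))) X > card {c \<in> Q. N c \<inter> X \<noteq> {}}"
        using not_less by blast
      have finX: "finite X" using X assms(2) finite_subset by blast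
      have sX: "s \<in> X" "card {c \<in> Q. N c \<inter> X \<noteq> {}} \<le> sum l X"
        using X lo[OF X(1)] fl[OF finX] by (auto split: if_splits)
      \<comment> \<open>\<open>A\<close> is tight from above and \<open>X\<close> from below. The
        upper condition for the members of \<open>A\<close> without neighbour in \<open>X\<close>,
        and the lower condition for the part of \<open>X\<close> outside \<open>?B\<close>, squeeze
        \<open>card (A \<inter> ?M)\<close> between \<open>sum u (?B \<inter> X)\<close> and
        \<open>sum l (?B \<inter> X)\<close>. This is impossible, as \<open>s\<close> lies in both
        sets and \<open>l s < u s\<close>.\<close>
      let ?M = "{c \<in> Q. N c \<inter> X \<noteq> {}}" and ?B = "\<Union> (N ` A)"
      have finA: "finite A" using A assms(1) finite_subset by blast
      have "card (A - ?M) \<le> sum u (\<Union> (N ` (A - ?M)))" using A by (intro up) auto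
      also have "\<dots> \<le> sum u (?B - X)" using A finN[OF A(1)] by (intro sum_mono2) auto
      finally have "card (A - ?M) \<le> sum u (?B - X)" .
      moreover have "card A = card (A - ?M) + card (A \<inter> ?M)"
        using card_Int_Diff[OF finA, of ?M] by simp
      moreover have "sum u ?B = sum u (?B - X) + sum u (?B \<inter> X)"
        using sum.Int_Diff[OF finN[OF A(1)], of u X] by simp
      ultimately have 1: "sum u (?B \<inter> X) \<le> card (A \<inter> ?M)" using sA(2) by linarith
      have "sum l (X - ?B) \<le> card {c \<in> Q. N c \<inter> (X - ?B) \<noteq> {}}" using X by (intro lo) auto
      also have "\<dots> \<le> card (?M - A)" using assms(1) by (intro card_mono) auto
      finally have "sum l (X - ?B) \<le> card (?M - A)" .
      moreover have "card ?M = card (?M - A) + card (A \<inter> ?M)"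
        using card_Int_Diff[of ?M A] assms(1) by (simp add: Int_commute)
      moreover have "sum l X = sum l (X - ?B) + sum l (?B \<inter> X)"
        using sum.Int_Diff[OF finX, of l ?B] by (simp add: Int_commute)
      ultimately have 2: "card (A \<inter> ?M) \<le> sum l (?B \<inter> X)" using sX by linarith
      have "sum l (?B \<inter> X) < sum u (?B \<inter> X)"
        using finX sX sA(1) s lu X(1) by (intro sum_strict_mono_ex1) auto
      then show False using 1 2 by linarith
    qed
  qed
qed

section \<open>Parity factors\<close>

text \<open>The assembly shared by both factor theorems. Existence inside components is the
  assumption \<open>IH\<close>, so that it can be supplied by an induction hypothesis as well as by
  a finished theorem; the degrees on \<open>S\<close> are left as loads of \<open>\<phi>\<close>, to
  be controlled by Hall's theorem.\<close>

lemma glue_factors: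
  assumes "sym E" "finite V" "S \<subseteq> V"
    and IH: "\<And>C h. C \<in> comps E (V - S) \<Longrightarrow>
      (\<And>T. T \<subseteq> C \<Longrightarrow> card (odd_comps E h (C - T)) \<le> sum h T) \<Longrightarrow> \<exists>F. parity_factor E C h F"
    and max: "\<And>R. R \<subseteq> V - S \<Longrightarrow> R \<noteq> {} \<Longrightarrow> even (card (odd_comps E f (V - S - R)) +
      card (odd_comps E f (V - S)) + sum f R) \<and>
      card (odd_comps E f (V - S - R)) < card (odd_comps E f (V - S)) + sum f R"
    and \<phi>: "\<And>C. C \<in> odd_comps E f (V - S) \<Longrightarrow> \<phi> C \<in> S \<and> (\<exists>v\<in>C. (\<phi> C, v) \<in> E)"
  shows "\<exists>F. F \<subseteq> E \<and> F \<subseteq> V \<times> V \<and> sym F \<and>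
    (\<forall>v\<in>V - S. deg F v \<le> f v \<and> even (deg F v + f v)) \<and>
    (\<forall>s\<in>S. deg F s = card {C \<in> odd_comps E f (V - S). \<phi> C = s})"
proof -
  let ?W = "V - S" and ?Q = "odd_comps E f (V - S)"
  have finW: "finite ?W" using assms(2) by simp
  obtain v where v: "\<And>C. C \<in> ?Q \<Longrightarrow> v C \<in> C \<and> (\<phi> C, v C) \<in> E"
    using \<phi> by metis
  have QC: "C \<in> comps E ?W" "odd (sum f C)" if "C \<in> ?Q" for C
    using that by (auto simp: odd_comps_def)
  have fin: "finite C" if "C \<in> comps E ?W" for C
    using comps_subset[OF that] finW finite_subset by blast
  \<comment> \<open>An odd component must leave room for the edge from \<open>v C\<close> to
    \<open>S\<close>; lowering the bound there also makes its total weight even.\<close>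
  define h where "h C = (if C \<in> ?Q then f(v C := f (v C) - 1) else f)" for C
  \<comment> \<open>The other components cancel from \<open>max\<close>. An odd \<open>C\<close>
    itself counts 1 in \<open>?Q\<close>, which leaves a surplus of one,
    \<open>card (odd_comps E f (C - T)) + 1 \<le> sum f T\<close>; for the remaining
    \<open>C\<close> the bound without surplus suffices.\<close>
  have local: "card (odd_comps E f (C - T)) + (if C \<in> ?Q then 2 else 1) \<le> sum f T + 1 \<and>
      even (card (odd_comps E f (C - T)) + (if C \<in> ?Q then 1 else 0) + sum f T)"
    if C: "C \<in> comps E ?W" and T: "T \<subseteq> C" "T \<noteq> {}" for C T
  proof -
    have TW: "T \<subseteq> ?W" using T comps_subset[OF C] by blast
    have "card (odd_comps E f (?W - T)) = card (odd_comps E f (C - T)) + card (odd_comps E f (?W - C))"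
      using odd_comps_Diff[OF assms(1) finW C T(1)] .
    moreover have "card ?Q = (if C \<in> ?Q then 1 else 0) + card (odd_comps E f (?W - C))"
      using odd_comps_Diff[OF assms(1) finW C, of "{}" f] card_odd_comps_self[OF C, of f] C
      by (simp add: odd_comps_def)
    ultimately show ?thesis using max[OF TW T(2)] by (cases "C \<in> ?Q"; simp; presburger)
  qed
  \<comment> \<open>Makes the truncated subtraction in \<open>h\<close> exact.\<close>
  have pos: "f (v C) \<ge> 1" if "C \<in> ?Q" for C
    using local[of C "{v C}"] QC[OF that] v[OF that] that by auto
  have "\<exists>F. parity_factor E C (h C) F" if C: "C \<in> comps E ?W" for C
  proof (rule IH[OF C])
    fix T assume T: "T \<subseteq> C"
    show "card (odd_comps E (h C) (C - T)) \<le> sum (h C) T"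
    proof (cases "C \<in> ?Q")
      case False
      then have "even (sum f C)" using C by (simp add: odd_comps_def)
      with False show ?thesis
        using local[OF C T] card_odd_comps_self[OF C, of f] by (cases "T = {}") (auto simp: h_def)
    next
      case True
      have h: "h C = f(v C := f (v C) - 1)" using True by (simp add: h_def)
      have vC: "v C \<in> C" using v[OF True] by simp
      have fT: "finite T" using T fin[OF C] finite_subset by blast
      have sum_h: "sum (h C) X + (if v C \<in> X then 1 else 0) = sum f X" if "finite X" for X
      proof (cases "v C \<in> X")
        case True
        then show ?thesis using that pos[OF \<open>C \<in> ?Q\<close>] sum.remove[OF that True, of f]
            sum.remove[OF that True, of "h C"] by (simp add: h)
      next
        case False
        then have "sum (h C) X = sum f X" by (intro sum.cong) (auto simp: h)
        then show ?thesis using False by simp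
      qed
      have finD: "finite D" if "D \<in> comps E (C - T)" for D
        using comps_subset[OF that] fin[OF C] finite_subset by blast
      \<comment> \<open>Lowering the bound at \<open>v C\<close> costs one unit of
        \<open>sum f T\<close> if \<open>v C\<close> is in \<open>T\<close>, and otherwise can turn
        only the component \<open>D0\<close> of \<open>v C\<close> odd. The surplus of one in
        \<open>local\<close> pays for either.\<close>
      consider "T = {}" | "T \<noteq> {}" "v C \<in> T" | "T \<noteq> {}" "v C \<notin> T" by blast
      then show ?thesis
      proof cases
        case 1
        have "even (sum (h C) C)" using sum_h[OF fin[OF C]] QC(2)[OF True] vC by presburger
        then show ?thesis using 1 card_odd_comps_self[OF C, of "h C"] by simp
      next
        case 2
        have "odd_comps E (h C) (C - T) = odd_comps E f (C - T)"
        proof -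
          have "sum (h C) D = sum f D" if "D \<in> comps E (C - T)" for D
            using sum_h[OF finD[OF that]] comps_subset[OF that] 2(2) by (auto split: if_splits)
          then show ?thesis by (auto simp: odd_comps_def)
        qed
        then show ?thesis using local[OF C T 2(1)] True sum_h[OF fT] 2(2) by simp
      next
        case 3
        obtain D0 where D0: "D0 \<in> comps E (C - T)" "v C \<in> D0"
          using Union_comps[OF assms(1), of "C - T"] fin[OF C] vC 3 by blast
        have "D \<in> odd_comps E f (C - T)" if D: "D \<in> odd_comps E (h C) (C - T)" "D \<noteq> D0" for D
        proof -
          have Dc: "D \<in> comps E (C - T)" using D by (simp add: odd_comps_def)
          have "v C \<notin> D" using comps_disjoint[OF Dc D0(1)] D0(2) D(2) by blast
          then show ?thesis using D(1) sum_h[OF finD[OF Dc]] by (simp add: odd_comps_def)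
        qed
        then have "odd_comps E (h C) (C - T) \<subseteq> insert D0 (odd_comps E f (C - T))" by blast
        then have "card (odd_comps E (h C) (C - T)) \<le> card (insert D0 (odd_comps E f (C - T)))"
          using fin[OF C] by (intro card_mono) (auto simp: finite_odd_comps)
        also have "\<dots> \<le> Suc (card (odd_comps E f (C - T)))" by (rule card_insert_le_m1) simp_all
        finally show ?thesis using local[OF C T 3(1)] True sum_h[OF fT] 3(2) by simp
      qed
    qed
  qed
  then obtain FC where FC: "\<And>C. C \<in> comps E ?W \<Longrightarrow> parity_factor E C (h C) (FC C)"
    by metis
  define F where "F = (\<Union>C\<in>comps E ?W. FC C) \<union> {(\<phi> C, v C) | C. C \<in> ?Q} \<union> {(v C, \<phi> C) | C. C \<in> ?Q}"
  have FCsub: "FC C \<subseteq> E" "FC C \<subseteq> C \<times> C" "sym (FC C)" if "C \<in> comps E ?W" for C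
    using FC[OF that] by (auto simp: parity_factor_def)
  have vW: "v C \<in> ?W" if "C \<in> ?Q" for C using v[OF that] comps_subset[OF QC(1)[OF that]] by blast
  have F_iff: "(a, c) \<in> F \<longleftrightarrow> (\<exists>C\<in>comps E ?W. (a, c) \<in> FC C) \<or>
      (\<exists>C\<in>?Q. a = \<phi> C \<and> c = v C \<or> a = v C \<and> c = \<phi> C)" for a c
    by (auto simp: F_def)
  have FCV: "a \<in> C \<and> c \<in> C" if "C \<in> comps E ?W" "(a, c) \<in> FC C" for a c C
    using FCsub(2)[OF that(1)] that(2) by blast
  have CW: "C \<subseteq> ?W" if "C \<in> comps E ?W" for C using comps_subset[OF that] .
  have "(a, c) \<in> E \<and> a \<in> V \<and> c \<in> V \<and> (c, a) \<in> F" if ac: "(a, c) \<in> F" for a c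
  proof -
    consider C where "C \<in> comps E ?W" "(a, c) \<in> FC C"
      | C where "C \<in> ?Q" "a = \<phi> C \<and> c = v C \<or> a = v C \<and> c = \<phi> C"
      using ac unfolding F_iff by blast
    then show ?thesis
    proof cases
      case 1
      then have "(c, a) \<in> FC C" using FCsub(3) by (metis symE)
      then have "(c, a) \<in> F" unfolding F_iff using 1(1) by blast
      then show ?thesis using FCsub(1)[OF 1(1)] FCV[OF 1] CW[OF 1(1)] 1(2) by blast
    next
      case 2
      have "\<phi> C \<in> V" "v C \<in> V" "(\<phi> C, v C) \<in> E" "(v C, \<phi> C) \<in> E"
        using \<phi>[OF 2(1)] vW[OF 2(1)] v[OF 2(1)] assms(1,3) by (auto dest: symD)
      moreover have "(c, a) \<in> F" unfolding F_iff using 2 by blast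
      ultimately show ?thesis using 2(2) by blast
    qed
  qed
  then have "F \<subseteq> E" "F \<subseteq> V \<times> V" "sym F" by (auto simp: sym_def)
  moreover have "deg F x \<le> f x \<and> even (deg F x + f x)" if x: "x \<in> ?W" for x
  proof -
    obtain C where C: "C \<in> comps E ?W" "x \<in> C" using Union_comps[OF assms(1) finW] x by blast
    have uniq: "D = C" if "D \<in> comps E ?W" "x \<in> D" for D
      using comps_disjoint[OF that(1) C(1)] that(2) C(2) by blast
    have FCx: "deg (FC C) x \<le> h C x" "even (deg (FC C) x + h C x)"
      using FC[OF C(1)] C(2) by (auto simp: parity_factor_def)
    have xS: "x \<noteq> \<phi> D" if "D \<in> ?Q" for D using \<phi>[OF that] x by blast
    have eq: "{w. (x, w) \<in> F} = {w. (x, w) \<in> FC C} \<union> (if C \<in> ?Q \<and> x = v C then {\<phi> C} else {})"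
    proof -
      have "(x, w) \<in> F \<longleftrightarrow> (x, w) \<in> FC C \<or> C \<in> ?Q \<and> x = v C \<and> w = \<phi> C" for w
      proof -
        have "(\<exists>D\<in>comps E ?W. (x, w) \<in> FC D) \<longleftrightarrow> (x, w) \<in> FC C"
          using uniq FCV C(1) by blast
        moreover have "D = C" if "D \<in> ?Q" "x = v D" for D
          using uniq[OF QC(1)[OF that(1)]] v[OF that(1)] that(2) by simp
        ultimately show ?thesis unfolding F_iff using xS by blast
      qed
      then show ?thesis by auto
    qed
    have fin_FC: "finite {w. (x, w) \<in> FC C}"
      using FCsub(2)[OF C(1)] fin[OF C(1)] by (auto intro: finite_subset[of _ C])
    show ?thesis
    proof (cases "C \<in> ?Q \<and> x = v C")
      case True
      \<comment> \<open>The attaching edge leaves \<open>C\<close>, so it is not in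
        \<open>FC C\<close> and gives back the unit removed in \<open>h C\<close>.\<close>
      have "\<phi> C \<notin> C" using \<phi> True comps_subset[OF C(1)] by blast
      then have "(x, \<phi> C) \<notin> FC C" using FCsub(2)[OF C(1)] by blast
      then have "deg F x = Suc (deg (FC C) x)"
        unfolding deg_def eq using True fin_FC by simp
      moreover have "Suc (h C x) = f x" using True pos[of C] by (auto simp: h_def)
      ultimately show ?thesis using FCx by (metis Suc_le_mono add_Suc add_Suc_right even_Suc)
    next
      case False
      then have "deg F x = deg (FC C) x" unfolding deg_def eq by auto
      moreover have "h C x = f x" using False by (auto simp: h_def)
      ultimately show ?thesis using FCx by metis
    qed
  qed
  moreover have "deg F s = card {C \<in> ?Q. \<phi> C = s}" if s: "s \<in> S" for s
  proof -
    have "{w. (s, w) \<in> F} = v ` {C \<in> ?Q. \<phi> C = s}"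
    proof -
      have "(\<exists>C\<in>comps E ?W. (s, w) \<in> FC C) = False" for w
        using FCV CW s by blast
      moreover have "s \<noteq> v C" if "C \<in> ?Q" for C using vW[OF that] s by blast
      ultimately have "(s, w) \<in> F \<longleftrightarrow> (\<exists>C\<in>?Q. s = \<phi> C \<and> w = v C)" for w
        unfolding F_iff by blast
      then show ?thesis by auto
    qed
    moreover have "inj_on v {C \<in> ?Q. \<phi> C = s}"
    proof (rule inj_onI)
      fix C D assume *: "C \<in> {C \<in> ?Q. \<phi> C = s}" "D \<in> {C \<in> ?Q. \<phi> C = s}" "v C = v D"
      then have "v C \<in> C \<inter> D" using v[of C] v[of D] by simp
      then show "C = D" using comps_disjoint[of C E ?W D] QC(1) * by blast
    qed
    ultimately show ?thesis by (simp add: deg_def card_image)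
  qed
  ultimately show ?thesis by blast
qed

text \<open>Both Hall conditions are statements about separators inside \<open>S\<close>. Components
  whose neighbours lie in \<open>T\<close> remain components after deleting only \<open>T\<close>,
  which bounds their number by \<open>upper\<close>; components that see nothing of \<open>X\<close>
  survive when \<open>X\<close> is put back, so \<open>lower\<close> at \<open>S - X\<close> forces
  many others to meet \<open>X\<close>.\<close>

lemma odd_comps_assignment:
  assumes "sym E" "finite V" "S \<subseteq> V" "\<And>s. s \<in> S \<Longrightarrow> l s \<le> u s"
    and upper: "\<And>T. T \<subseteq> V \<Longrightarrow> card (odd_comps E f (V - T)) \<le> sum u T"
    and lower: "\<And>T. T \<subseteq> S \<Longrightarrow>
      card (odd_comps E f (V - T)) + sum l S \<le> card (odd_comps E f (V - S)) + sum l T"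
  obtains \<phi> where
    "\<And>C. C \<in> odd_comps E f (V - S) \<Longrightarrow> \<phi> C \<in> S \<and> (\<exists>v\<in>C. (\<phi> C, v) \<in> E)"
    "\<And>s. s \<in> S \<Longrightarrow> l s \<le> card {C \<in> odd_comps E f (V - S). \<phi> C = s}"
    "\<And>s. s \<in> S \<Longrightarrow> card {C \<in> odd_comps E f (V - S). \<phi> C = s} \<le> u s"
proof -
  let ?Q = "odd_comps E f (V - S)" and ?N = "\<lambda>C. {s \<in> S. \<exists>v\<in>C. (s, v) \<in> E}"
  have finQ: "finite ?Q" using assms(2) by (simp add: finite_odd_comps)
  have finS: "finite S" using assms(2,3) finite_subset by blast
  have still: "C \<in> odd_comps E f (V - T)" if C: "C \<in> ?Q" and T: "?N C \<subseteq> T" "T \<subseteq> S" for C T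
  proof -
    have Cc: "C \<in> comps E (V - S)" "odd (sum f C)" using C by (auto simp: odd_comps_def)
    have "C \<in> comps E (V - T)"
    proof (rule comps_enlarge[OF assms(1) Cc(1)])
      show "V - S \<subseteq> V - T" using T by blast
      fix x y assume "x \<in> C" "y \<in> V - T - (V - S)"
      then show "(x, y) \<notin> E" using T assms(1) unfolding sym_def by blast
    qed
    then show ?thesis using Cc(2) by (simp add: odd_comps_def)
  qed
  have "\<exists>\<phi>. (\<forall>C\<in>?Q. \<phi> C \<in> ?N C) \<and>
    (\<forall>s\<in>S. l s \<le> card {C \<in> ?Q. \<phi> C = s} \<and> card {C \<in> ?Q. \<phi> C = s} \<le> u s)"
  proof (rule capacitated_hall_bounds[OF finQ finS])
    fix A assume A: "A \<subseteq> ?Q"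
    let ?T = "\<Union> (?N ` A)"
    have "A \<subseteq> odd_comps E f (V - ?T)" using still[of _ ?T] A by blast
    then have "card A \<le> card (odd_comps E f (V - ?T))"
      using assms(2) by (intro card_mono) (auto simp: finite_odd_comps)
    also have "\<dots> \<le> sum u ?T" using assms(3) by (intro upper) blast
    finally show "card A \<le> sum u ?T" .
  next
    fix X assume X: "X \<subseteq> S"
    define M where "M = {C \<in> ?Q. ?N C \<inter> X \<noteq> {}}"
    have "?Q - M \<subseteq> odd_comps E f (V - (S - X))"
    proof
      fix C assume "C \<in> ?Q - M"
      then have "C \<in> ?Q" "?N C \<inter> X = {}" unfolding M_def by blast+
      then show "C \<in> odd_comps E f (V - (S - X))" using still[of C "S - X"] by blast
    qed
    then have "card (?Q - M) \<le> card (odd_comps E f (V - (S - X)))"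
      using assms(2) by (intro card_mono) (auto simp: finite_odd_comps)
    moreover have "card (?Q - M) + card M = card ?Q"
    proof -
      have "?Q \<inter> M = M" unfolding M_def by blast
      then show ?thesis using card_Int_Diff[OF finQ, of M] by simp
    qed
    moreover have "sum l S = sum l (S - X) + sum l X" using X finS by (rule sum.subset_diff)
    moreover have "card (odd_comps E f (V - (S - X))) + sum l S \<le> card ?Q + sum l (S - X)"
      by (intro lower) blast
    ultimately have "sum l X \<le> card M" by linarith
    then show "sum l X \<le> card {C \<in> ?Q. ?N C \<inter> X \<noteq> {}}" by (simp add: M_def)
  qed (use assms(4) in auto)
  then show ?thesis using that by blast
qed

text \<open>Two nested inductions. A nonempty tight set splits the graph into strictly smaller
  components, to which the induction on \<open>card V\<close> applies for all bounds; without one,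
  the total demand \<open>sum f V\<close> is lowered on the same vertex set.\<close>

theorem parity_factor_exists:
  assumes "sym E" "finite V"
    and "\<And>T. T \<subseteq> V \<Longrightarrow> card (odd_comps E f (V - T)) \<le> sum f T"
  shows "\<exists>F. parity_factor E V f F"
  using assms(2,3)
proof (induction "card V" arbitrary: V f rule: less_induct)
  case less
  note IH_V = less.hyps and finV = less.prems(1)
  from less.prems(2) show ?case
  proof (induction "sum f V" arbitrary: f rule: less_induct)
    case (less f)
    note IH_f = less.hyps and cond = less.prems
    \<comment> \<open>The condition at the empty set excludes odd components altogether, so the
      total weight is even.\<close>
    have par: "even (card (odd_comps E f (V - T)) + sum f T)" if "T \<subseteq> V" for T
    proof -
      have "even (sum f V)"
        using cond[of "{}"] odd_comps_parity[OF assms(1) finV, of f] by simp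
      moreover have "sum f V = sum f (V - T) + sum f T"
        using that finV sum.subset_diff by blast
      ultimately show ?thesis
        using odd_comps_parity[OF assms(1), of "V - T" f] finV by (metis even_add finite_Diff)
    qed
    show ?case
    proof (cases "\<exists>T\<subseteq>V. T \<noteq> {} \<and> card (odd_comps E f (V - T)) = sum f T")
      case True
      define tight where "tight T \<longleftrightarrow> T \<subseteq> V \<and> T \<noteq> {} \<and> card (odd_comps E f (V - T)) = sum f T" for T
      have "finite {T. tight T}"
        using finV by (auto intro: finite_subset[of _ "Pow V"] simp: tight_def)
      moreover have "{T. tight T} \<noteq> {}" using True by (auto simp: tight_def)
      ultimately obtain S where S: "tight S" and Smax: "\<And>T. tight T \<Longrightarrow> S \<subseteq> T \<Longrightarrow> S = T"
        using finite_has_maximal[of "{T. tight T}"] by auto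
      have S': "S \<subseteq> V" "S \<noteq> {}" "card (odd_comps E f (V - S)) = sum f S"
        using S by (auto simp: tight_def)
      have finS: "finite S" using S' finV finite_subset by blast
      let ?Q = "odd_comps E f (V - S)"
      \<comment> \<open>Since \<open>S\<close> is tight, the hypothesis doubles as the lower
        condition, and with equal lower and upper bounds every load is exactly
        \<open>f s\<close>.\<close>
      have low: "card (odd_comps E f (V - T)) + sum f S \<le> card ?Q + sum f T" if "T \<subseteq> S" for T
        using cond[of T] that S' by simp
      obtain \<phi> where \<phi>: "\<And>C. C \<in> ?Q \<Longrightarrow> \<phi> C \<in> S \<and> (\<exists>v\<in>C. (\<phi> C, v) \<in> E)"
        and load: "\<And>s. s \<in> S \<Longrightarrow> f s \<le> card {C \<in> ?Q. \<phi> C = s}"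
          "\<And>s. s \<in> S \<Longrightarrow> card {C \<in> ?Q. \<phi> C = s} \<le> f s"
        using odd_comps_assignment[OF assms(1) finV S'(1) order_refl cond low] by blast
      have load: "card {C \<in> ?Q. \<phi> C = s} = f s" if "s \<in> S" for s
        using load[OF that] by (rule le_antisym[rotated])
      have "\<exists>F. F \<subseteq> E \<and> F \<subseteq> V \<times> V \<and> sym F \<and>
        (\<forall>v\<in>V - S. deg F v \<le> f v \<and> even (deg F v + f v)) \<and>
        (\<forall>s\<in>S. deg F s = card {C \<in> ?Q. \<phi> C = s})"
      proof (rule glue_factors[OF assms(1) finV S'(1)])
        fix C h assume C: "C \<in> comps E (V - S)"
          and hC: "\<And>T. T \<subseteq> C \<Longrightarrow> card (odd_comps E h (C - T)) \<le> sum h T"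
        have "C \<subset> V" using comps_subset[OF C] S' by blast
        then have "card C < card V" "finite C"
          using finV psubset_card_mono finite_subset by auto
        then show "\<exists>F. parity_factor E C h F" using IH_V hC by blast
      next
        fix R assume R: "R \<subseteq> V - S" "R \<noteq> {}"
        have SR: "S \<union> R \<subseteq> V" "V - (S \<union> R) = V - S - R" using R S'(1) by auto
        have sumSR: "sum f (S \<union> R) = sum f S + sum f R"
          using R finS finV by (intro sum.union_disjoint) (auto intro: finite_subset)
        have "\<not> tight (S \<union> R)" using Smax[of "S \<union> R"] R by blast
        then have "card (odd_comps E f (V - S - R)) \<noteq> sum f S + sum f R"
          using SR S'(2) sumSR by (auto simp: tight_def)
        then show "even (card (odd_comps E f (V - S - R)) + card ?Q + sum f R) \<and>
          card (odd_comps E f (V - S - R)) < card ?Q + sum f R"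
          using cond[OF SR(1)] par[OF SR(1)] SR(2) sumSR S'(3) by (simp add: add.assoc)
      qed (rule \<phi>)
      then obtain F where "F \<subseteq> E" "F \<subseteq> V \<times> V" "sym F"
        "\<forall>v\<in>V - S. deg F v \<le> f v \<and> even (deg F v + f v)" "\<forall>s\<in>S. deg F s = f s"
        using load by auto
      then have "parity_factor E V f F" by (auto simp: parity_factor_def)
      then show ?thesis by blast
    next
      case False
      show ?thesis
      proof (cases "V = {}")
        case True
        then show ?thesis by (intro exI[of _ "{}"]) (simp add: parity_factor_def sym_def)
      next
        case Vne: False
        then obtain x where x: "x \<in> V" by blast
        have slack: "card (odd_comps E f (V - T)) + 2 \<le> sum f T" if "T \<subseteq> V" "T \<noteq> {}" for T
        proof -
          have "card (odd_comps E f (V - T)) \<noteq> sum f T" using False that by blast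
          then have "card (odd_comps E f (V - T)) < sum f T" using cond[OF that(1)] by simp
          moreover have "Suc (card (odd_comps E f (V - T))) \<noteq> sum f T" using par[OF that(1)] by (metis even_Suc even_add)
          ultimately show ?thesis by simp
        qed
        \<comment> \<open>by parity every slack is at least 2, so lowering \<open>f x\<close> by 2 keeps the condition\<close>
        have fx: "f x \<ge> 2" using slack[of "{x}"] x by simp
        let ?f = "f(x := f x - 2)"
        have sum_f: "sum ?f T + (if x \<in> T then 2 else 0) = sum f T" if "finite T" for T
        proof (cases "x \<in> T")
          case True
          then show ?thesis using that fx sum.remove[OF that True, of f]
              sum.remove[OF that True, of ?f] by simp
        next
          case False
          then have "sum ?f T = sum f T" by (intro sum.cong) auto
          then show ?thesis using False by simp
        qed
        have oc: "odd_comps E ?f W = odd_comps E f W" if "finite W" for W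
        proof -
          have "odd (sum ?f C) \<longleftrightarrow> odd (sum f C)" if "C \<in> comps E W" for C
          proof -
            have "finite C" using comps_subset[OF that] \<open>finite W\<close> finite_subset by blast
            show ?thesis unfolding sum_f[OF \<open>finite C\<close>, symmetric] by simp
          qed
          then show ?thesis by (auto simp: odd_comps_def)
        qed
        have "\<exists>F. parity_factor E V ?f F"
        proof (rule IH_f)
          show "sum ?f V < sum f V" using sum_f[OF finV] x by simp
          fix T assume T: "T \<subseteq> V"
          have "finite T" using T finV finite_subset by blast
          then show "card (odd_comps E ?f (V - T)) \<le> sum ?f T"
            using sum_f[of T] slack[OF T] cond[OF T] oc[of "V - T"] finV
            by (cases "T = {}") (auto split: if_splits)
        qed
        then obtain F where F: "parity_factor E V ?f F" by blast
        have "?f v \<le> f v" "even (?f v) = even (f v)" for v using fx by auto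
        with F have "parity_factor E V f F"
          unfolding parity_factor_def by (meson even_add le_trans)
        then show ?thesis by blast
      qed
    qed
  qed
qed

text \<open>Outside \<open>S\<close> the degrees keep the odd parity of \<open>f v\<close>, so the
  value \<open>Suc (f v)\<close> can occur only on \<open>S\<close>. Extremality for the weight
  \<open>f\<close> supplies the lower loads, the hypothesis for \<open>Suc (f v)\<close> the upper
  ones.\<close>

theorem odd_or_succ_factor_exists:
  assumes "sym E" "finite V"
    and cond: "\<And>T. T \<subseteq> V \<Longrightarrow> card (odd_comps E f (V - T)) \<le> (\<Sum>v\<in>T. Suc (f v))"
    and odd: "\<And>v. v \<in> V \<Longrightarrow> odd (f v)"
  obtains F where "F \<subseteq> E" "F \<subseteq> V \<times> V" "sym F"
    "\<And>v. v \<in> V \<Longrightarrow> odd (deg F v) \<and> deg F v \<le> f v \<or> deg F v = Suc (f v)"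
proof -
  define p where "p S = int (card (odd_comps E f (V - S))) - int (sum f S)" for S
  define M where "M = {S \<in> Pow V. \<forall>T\<in>Pow V. p T \<le> p S}"
  have "Max (p ` Pow V) \<in> p ` Pow V" using assms(2) by (intro Max_in) auto
  then obtain S where "S \<in> Pow V" "p S = Max (p ` Pow V)" by (metis imageE)
  then have "S \<in> M" using assms(2) by (auto simp: M_def)
  then have "M \<noteq> {}" by blast
  moreover have "finite M" using assms(2) by (auto simp: M_def)
  ultimately obtain S where S: "S \<in> M" and Smax: "\<And>T. T \<in> M \<Longrightarrow> S \<subseteq> T \<Longrightarrow> S = T"
    using finite_has_maximal[of M] by auto
  have SV: "S \<subseteq> V" and pS: "\<And>T. T \<subseteq> V \<Longrightarrow> p T \<le> p S" using S by (auto simp: M_def)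
  have strict: "p T < p S" if TV: "T \<subseteq> V" and ST: "S \<subset> T" for T
  proof -
    have "T \<notin> M" using Smax ST by blast
    then obtain U where "U \<subseteq> V" "p T < p U" using TV by (auto simp: M_def not_le)
    then show ?thesis using pS[of U] by simp
  qed
  have finS: "finite S" using SV assms(2) finite_subset by blast
  let ?Q = "odd_comps E f (V - S)"
  have low: "card (odd_comps E f (V - T)) + sum f S \<le> card ?Q + sum f T" if "T \<subseteq> S" for T
  proof -
    have "p T \<le> p S" using pS that SV by blast
    then show ?thesis unfolding p_def by linarith
  qed
  obtain \<phi> where \<phi>: "\<And>C. C \<in> ?Q \<Longrightarrow> \<phi> C \<in> S \<and> (\<exists>v\<in>C. (\<phi> C, v) \<in> E)"
    and load: "\<And>s. s \<in> S \<Longrightarrow> f s \<le> card {C \<in> ?Q. \<phi> C = s}"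
      "\<And>s. s \<in> S \<Longrightarrow> card {C \<in> ?Q. \<phi> C = s} \<le> Suc (f s)"
    using odd_comps_assignment[where l = f and u = "\<lambda>v. Suc (f v)", OF assms(1,2) SV _ cond low] by auto
  have "\<exists>F. F \<subseteq> E \<and> F \<subseteq> V \<times> V \<and> sym F \<and>
      (\<forall>v\<in>V - S. deg F v \<le> f v \<and> even (deg F v + f v)) \<and>
      (\<forall>s\<in>S. deg F s = card {C \<in> ?Q. \<phi> C = s})"
  proof (rule glue_factors[OF assms(1,2) SV])
    fix C h assume C: "C \<in> comps E (V - S)"
      and hC: "\<And>T. T \<subseteq> C \<Longrightarrow> card (odd_comps E h (C - T)) \<le> sum h T"
    have "finite C" using comps_subset[OF C] assms(2) finite_subset by blast
    from parity_factor_exists[OF assms(1) this hC] show "\<exists>F. parity_factor E C h F" .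
  next
    fix R assume R: "R \<subseteq> V - S" "R \<noteq> {}"
    have VR: "V - (S \<union> R) = V - S - R" by blast
    have "sum f (S \<union> R) = sum f S + sum f R"
      using R finS assms(2) by (intro sum.union_disjoint) (auto intro: finite_subset)
    moreover have "p (S \<union> R) < p S" using R SV by (intro strict) auto
    ultimately have "card (odd_comps E f (V - S - R)) < card ?Q + sum f R"
      unfolding p_def VR by linarith
    moreover have "sum f (V - S) = sum f (V - S - R) + sum f R"
      using R assms(2) by (intro sum.subset_diff) auto
    then have "even (card (odd_comps E f (V - S - R)) + card ?Q + sum f R)"
      using odd_comps_parity[OF assms(1), of "V - S - R" f] odd_comps_parity[OF assms(1), of "V - S" f]
        assms(2) by (metis even_add finite_Diff)
    ultimately show "even (card (odd_comps E f (V - S - R)) + card ?Q + sum f R) \<and>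
        card (odd_comps E f (V - S - R)) < card ?Q + sum f R" by blast
  qed (rule \<phi>)
  then obtain F where F: "F \<subseteq> E" "F \<subseteq> V \<times> V" "sym F"
    "\<And>v. v \<in> V - S \<Longrightarrow> deg F v \<le> f v \<and> even (deg F v + f v)"
    "\<And>s. s \<in> S \<Longrightarrow> deg F s = card {C \<in> ?Q. \<phi> C = s}" by blast
  have "odd (deg F v) \<and> deg F v \<le> f v \<or> deg F v = Suc (f v)" if v: "v \<in> V" for v
  proof (cases "v \<in> S")
    case True
    then have "deg F v = f v \<or> deg F v = Suc (f v)" using F(5) load[of v] by fastforce
    then show ?thesis using odd[OF v] by auto
  next
    case False
    then show ?thesis using F(4)[of v] odd[OF v] v by auto
  qed
  then show ?thesis using that F(1-3) by blast
qed

section \<open>Counting edges\<close>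

lemma card_mult_le_sum:
  fixes x :: "'i \<Rightarrow> int"
  assumes "\<And>i. i \<in> I \<Longrightarrow> m \<le> x i" "m \<ge> 1" "p \<le> int (card I)"
  shows "p * m \<le> sum x I"
proof -
  have "p * m \<le> int (card I) * m" using assms(2,3) by (intro mult_right_mono) auto
  also have "\<dots> \<le> sum x I" using assms(1) by (intro sum_bounded_below) auto
  finally show ?thesis .
qed

text \<open>At least p - 1 other summands take up \<open>m\<close> each, so one summand can exceed
  \<open>m\<close> by no more than the whole surplus.\<close>

lemma summand_le:
  fixes x :: "'i \<Rightarrow> int"
  assumes "finite I" "\<And>i. i \<in> I \<Longrightarrow> m \<le> x i" "m \<ge> 1" "p \<le> int (card I)" "i \<in> I"
  shows "x i \<le> m + (sum x I - p * m)"
proof -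
  have "int (card (I - {i})) = int (card I) - 1"
    using assms(1,5) card_Suc_Diff1[of I i] by linarith
  then have "(p - 1) * m \<le> sum x (I - {i})"
    using assms(2-4) by (intro card_mult_le_sum) auto
  then show ?thesis
    using sum.remove[OF assms(1,5), of x] by (simp add: algebra_simps)
qed

text \<open>The convexity defect in exact form: a product vanishes precisely at the ends
  \<open>m\<close> and \<open>m + Z\<close> of the range of the summands, and the last term accounts
  for summands beyond \<open>p\<close>. Inequality and equality case both follow from it.\<close>

lemma sum_squares_defect:
  fixes x :: "'i \<Rightarrow> int" and I :: "'i set" and m p :: int
  defines "Z \<equiv> sum x I - p * m"
  shows "m * sum x I + (m + Z) * Z - (\<Sum>i\<in>I. (x i)\<^sup>2) =
    (\<Sum>i\<in>I. (x i - m) * (m + Z - x i)) + (m + Z) * (int (card I) * m - p * m)"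
proof -
  have "(\<Sum>i\<in>I. (x i - m) * (m + Z - x i)) =
      (\<Sum>i\<in>I. (m + (m + Z)) * x i - (x i)\<^sup>2 - m * (m + Z))"
    by (intro sum.cong) (auto simp: algebra_simps power2_eq_square)
  also have "\<dots> = (m + (m + Z)) * sum x I - (\<Sum>i\<in>I. (x i)\<^sup>2) - int (card I) * (m * (m + Z))"
    by (simp add: sum_subtractf sum_distrib_left)
  finally show ?thesis by (simp add: Z_def algebra_simps)
qed

text \<open>The right-hand side is the sum of squares of p - 1 values \<open>m\<close> and one value
  \<open>m + Z\<close>, where \<open>Z\<close> is the surplus of the sum over
  \<open>p * m\<close>.\<close>

lemma sum_squares_le:
  fixes x :: "'i \<Rightarrow> int"
  assumes "finite I" "\<And>i. i \<in> I \<Longrightarrow> m \<le> x i" "m \<ge> 1" "p \<le> int (card I)"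
  shows "(\<Sum>i\<in>I. (x i)\<^sup>2) \<le> m * sum x I + (m + (sum x I - p * m)) * (sum x I - p * m)"
proof -
  have "(\<Sum>i\<in>I. (x i - m) * (m + (sum x I - p * m) - x i)) \<ge> 0"
    using summand_le[where x = x, OF assms] assms(2) by (intro sum_nonneg mult_nonneg_nonneg) simp_all
  moreover have "p * m \<le> int (card I) * m" using assms(3,4) by (intro mult_right_mono) auto
  moreover have "0 \<le> m + (sum x I - p * m)"
    using card_mult_le_sum[where x = x, OF assms(2-4)] assms(3) by simp
  ultimately show ?thesis
    using sum_squares_defect[of m x I p] mult_nonneg_nonneg[of "m + (sum x I - p * m)" "int (card I) * m - p * m"]
    by linarith
qed

text \<open>Equality makes every product in the defect vanish, so each summand is \<open>m\<close>
  or \<open>m + Z\<close>, and makes \<open>card I * m\<close> equal to \<open>p * m\<close>. As Z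
  \<ge> 1, some summand is \<open>m + Z\<close>, and it already uses up the surplus.\<close>

lemma sum_squares_eqD:
  fixes x :: "'i \<Rightarrow> int"
  assumes "finite I" "\<And>i. i \<in> I \<Longrightarrow> m \<le> x i" "m \<ge> 1" "p \<le> int (card I)"
    and Z: "Z = sum x I - p * m" "Z \<ge> 1"
    and eq: "(\<Sum>i\<in>I. (x i)\<^sup>2) = m * sum x I + (m + Z) * Z"
  shows "\<exists>i\<in>I. x i = m + Z \<and> (\<forall>j\<in>I - {i}. x j = m)"
proof -
  have nonneg: "(x i - m) * (m + Z - x i) \<ge> 0" if "i \<in> I" for i
    using summand_le[where x = x, OF assms(1-4) that] assms(2)[OF that] Z(1) by simp
  have pm: "p * m \<le> int (card I) * m" using assms(3,4) by (intro mult_right_mono) auto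
  then have "(m + Z) * (int (card I) * m - p * m) \<ge> 0" using assms(3) Z(2) by simp
  moreover have "(\<Sum>i\<in>I. (x i - m) * (m + Z - x i)) \<ge> 0" using nonneg by (rule sum_nonneg)
  ultimately have zero: "(\<Sum>i\<in>I. (x i - m) * (m + Z - x i)) = 0"
      "(m + Z) * (int (card I) * m - p * m) = 0"
    using sum_squares_defect[of m x I p] eq unfolding Z(1) by linarith+
  have each: "(x i - m) * (m + Z - x i) = 0" if "i \<in> I" for i
    using zero(1) sum_nonneg_eq_0_iff[OF assms(1) nonneg] that by simp
  have card: "int (card I) * m = p * m" using zero(2) assms(3) Z(2) by simp
  have "\<exists>i\<in>I. x i \<noteq> m"
  proof (rule ccontr)
    assume "\<not> ?thesis"
    then have "sum x I = int (card I) * m" by simp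
    then show False using card Z by simp
  qed
  then obtain i where i: "i \<in> I" "x i \<noteq> m" by blast
  then have xi: "x i = m + Z" using each[OF i(1)] by simp
  have "sum x (I - {i}) = (int (card I) - 1) * m"
    using sum.remove[OF assms(1) i(1), of x] xi card Z(1) by (simp add: algebra_simps)
  also have "\<dots> = (\<Sum>j\<in>I - {i}. m)"
    using i(1) assms(1) card_Suc_Diff1[of I i] by simp
  finally have "(\<Sum>j\<in>I - {i}. x j - m) = 0" by (simp add: sum_subtractf)
  then have "x j = m" if "j \<in> I - {i}" for j
    using sum_nonneg_eq_0_iff[of "I - {i}" "\<lambda>j. x j - m"] assms(1,2) that by simp
  then show ?thesis using i(1) xi by blast
qed

section \<open>Comparison with the size of the extremal graph\<close>

text \<open>After multiplication by \<open>b\<close>, the hypothesis exceeds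
  \<open>(b - 1) * ((b + 1) * (b + 2) * d - 1)\<close> by 2d - 1 > 0; cancelling b - 1 leaves a
  strict inequality, which integrality sharpens by one.\<close>

lemma order_lower_bound_mult:
  fixes b d n :: int
  assumes "b \<ge> 2" "d \<ge> 1" "(b - 1) * n \<ge> b\<^sup>2 * d + 2 * b * d - d - 1"
  shows "b * n \<ge> (b + 1) * (b + 2) * d"
proof -
  have "b * (b\<^sup>2 * d + 2 * b * d - d - 1) \<le> b * ((b - 1) * n)"
    using assms by (intro mult_left_mono) auto
  then have "(b - 1) * ((b + 1) * (b + 2) * d - 1) < (b - 1) * (b * n)"
    using assms(2) by (simp add: algebra_simps power2_eq_square)
  then show ?thesis using assms(1) by (simp add: mult_less_cancel_left_pos)
qed

lemma order_lower_bound: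
  fixes b d n :: int
  assumes "b \<ge> 2" "d \<ge> 1" "b * n \<ge> (b + 1) * (b + 2) * d"
  shows "n \<ge> (b + 3) * d"
proof -
  have "b * ((b + 3) * d) \<le> (b + 1) * (b + 2) * d" using assms by (simp add: algebra_simps)
  then have "b * ((b + 3) * d) \<le> b * n" using assms(3) by linarith
  then show ?thesis using assms(1) by simp
qed

text \<open>
  The left-hand sides of the next two estimates bound twice the number of edges when deleting $s$ vertices
  leaves $bs + 1$ components: all but one of order $1$ (resp. $m$), the last of order $1 + Z$
  (resp. $m + Z$). The right-hand sides are twice the size of the extremal graph.
\<close>

lemma large_separator_count:
  fixes b d n s Z :: int
  assumes "b \<ge> 2" "d \<ge> 1" "s > d" "b * n \<ge> (b + 1) * (b + 2) * d"
    and Z: "Z = n - s - (b * s + 1)" "Z \<ge> 0"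
    and k: "k = n - (b + 1) * d"
  shows "s * n + s * (n - s) + (n - s) + (1 + Z) * Z - n
    < d * (d - 1) + k * (k - 1) + 2 * d * (n - d)"
proof -
  \<comment> \<open>The two counts differ by
    \<open>b * (s - d) * (2 * n - (b + 2) * (s + d) - 1)\<close>, so only the last factor needs an
    argument. Here Z \<ge> 0 bounds \<open>s\<close> by \<open>n\<close>, and the order hypothesis
    bounds \<open>d\<close>.\<close>
  have "(b + 2) * ((b + 1) * s) \<le> (b + 2) * (n - 1)"
    using assms(1) Z by (intro mult_left_mono) (auto simp: algebra_simps)
  then have "(b + 1) * (2 * n - (b + 2) * (s + d) - 1) \<ge> 1"
    using assms(4) by (simp add: algebra_simps)
  then have "0 < (b + 1) * (2 * n - (b + 2) * (s + d) - 1)" by simp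
  then have "2 * n - (b + 2) * (s + d) - 1 > 0"
    using assms(1) by (auto simp only: zero_less_mult_iff)
  then have "b * (s - d) * (2 * n - (b + 2) * (s + d) - 1) > 0" using assms by simp
  moreover have "d * (d - 1) + k * (k - 1) + 2 * d * (n - d) -
      (s * n + s * (n - s) + (n - s) + (1 + Z) * Z - n) = b * (s - d) * (2 * n - (b + 2) * (s + d) - 1)"
    unfolding Z k by (simp add: algebra_simps)
  ultimately show ?thesis by linarith
qed

lemma small_separator_count:
  fixes b d n s m Z :: int
  assumes "b \<ge> 2" "1 \<le> s" "s < d" "n \<ge> (b + 3) * d"
    and m: "m = d + 1 - s" and Z: "Z = n - s - (b * s + 1) * m" "Z \<ge> 0"
    and k: "k = n - (b + 1) * d"
  shows "s * n + s * (n - s) + m * (n - s) + (m + Z) * Z - n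
    < d * (d - 1) + k * (k - 1) + 2 * d * (n - d)"
proof -
  \<comment> \<open>\<open>?K\<close> is the number of vertices in the components of minimum order,
    \<open>?B\<close> that of the isolated vertices in the extremal graph's second part. The
    difference of the counts is a product with factor \<open>?K - ?B\<close> plus
    \<open>?B * (d - s)\<close>; the latter gives strictness, since the former vanishes for s =
    1.\<close>
  let ?K = "b * s * m" and ?B = "b * d"
  have "?K - ?B = b * ((s - 1) * (d - s))" using m by algebra
  then have 1: "?K - ?B \<ge> 0" using assms(1-3) by simp
  have "n = Z + s + ?K + m" using Z(1) by (simp add: algebra_simps)
  then have "n \<ge> ?K + d + 1" using Z(2) m by linarith
  moreover have "n \<ge> ?B + s" using assms(1-4) by (simp add: algebra_simps)
  ultimately have "2 * n - ?K - ?B - 1 - s - d \<ge> 0" by linarith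
  with 1 have "(?K - ?B) * (2 * n - ?K - ?B - 1 - s - d) \<ge> 0" by simp
  moreover have "?B * (d - s) > 0" using assms(1-3) by simp
  moreover have "d * (d - 1) + k * (k - 1) + 2 * d * (n - d) -
      (s * n + s * (n - s) + m * (n - s) + (m + Z) * Z - n) =
      (?K - ?B) * (2 * n - ?K - ?B - 1 - s - d) + ?B * (d - s)"
    unfolding Z k m by (simp add: algebra_simps)
  ultimately show ?thesis by linarith
qed

section \<open>Arc counts of the constructed graphs\<close>

lemma card_parcs_eq_twice_size:
  assumes "pair_graph G"
  shows "card (parcs G) = 2 * graph_size G"
proof -
  have fin: "finite (parcs G)" and irr: "irrefl (parcs G)"
    and sym: "\<And>x y. (x, y) \<in> parcs G \<Longrightarrow> (y, x) \<in> parcs G"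
    using assms by (auto simp: pair_graph_iff sym_def intro: finite_subset)
  have fiber: "card {a \<in> parcs G. {fst a, snd a} = e} = 2" if "e \<in> uedges G" for e
  proof -
    obtain x y where xy: "e = {x, y}" "(x, y) \<in> parcs G" using \<open>e \<in> uedges G\<close> by (auto simp: uedges_def)
    have "x \<noteq> y" using xy(2) irr by (auto simp: irrefl_def)
    have "{a \<in> parcs G. {fst a, snd a} = e} = {(x, y), (y, x)}"
      using xy sym by (auto simp: doubleton_eq_iff)
    then show ?thesis using \<open>x \<noteq> y\<close> by simp
  qed
  have eq: "uedges G = (\<lambda>a. {fst a, snd a}) ` parcs G" by (force simp: uedges_def)
  have "card (parcs G) = (\<Sum>e\<in>uedges G. card {a \<in> parcs G. {fst a, snd a} = e})"
    unfolding eq using fin by (subst card_eq_sum, subst sum.image_gen[of _ _ "\<lambda>a. {fst a, snd a}"]) auto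
  also have "\<dots> = 2 * graph_size G" using fiber by (simp add: graph_size_def)
  finally show ?thesis .
qed

lemma card_parcs_disjoint_union:
  fixes G :: "'a pair_pre_digraph" and H :: "'b pair_pre_digraph"
  assumes "finite (parcs G)" "finite (parcs H)"
  shows "card (parcs (disjoint_union G H)) = card (parcs G) + card (parcs H)"
proof -
  define A :: "(('a + 'b) \<times> ('a + 'b)) set" where "A = map_prod Inl Inl ` parcs G"
  define B :: "(('a + 'b) \<times> ('a + 'b)) set" where "B = map_prod Inr Inr ` parcs H"
  have "card (A \<union> B) = card A + card B"
    using assms by (intro card_Un_disjoint) (auto simp: A_def B_def)
  also have "card A = card (parcs G)"
    unfolding A_def by (intro card_image inj_on_subset[OF prod.inj_map]) auto
  also have "card B = card (parcs H)"
    unfolding B_def by (intro card_image inj_on_subset[OF prod.inj_map]) auto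
  finally show ?thesis by (simp add: disjoint_union_def A_def B_def)
qed

lemma card_parcs_graph_join:
  fixes G :: "'a pair_pre_digraph" and H :: "'b pair_pre_digraph"
  assumes "pair_graph G" "pair_graph H"
  shows "card (parcs (graph_join G H)) =
    card (parcs G) + card (parcs H) + 2 * (card (pverts G) * card (pverts H))"
proof -
  have fin: "finite (parcs G)" "finite (parcs H)" "finite (pverts G)" "finite (pverts H)"
    using assms by (auto simp: pair_graph_iff intro: finite_subset)
  define A :: "(('a + 'b) \<times> ('a + 'b)) set" where "A = Inl ` pverts G \<times> Inr ` pverts H"
  define B :: "(('a + 'b) \<times> ('a + 'b)) set" where "B = Inr ` pverts H \<times> Inl ` pverts G"
  have "parcs (graph_join G H) = parcs (disjoint_union G H) \<union> (A \<union> B)"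
    by (simp add: graph_join_def Un_assoc A_def B_def)
  moreover have "finite (parcs (disjoint_union G H))" using fin by (simp add: disjoint_union_def)
  moreover have "parcs (disjoint_union G H) \<inter> (A \<union> B) = {}"
    by (auto simp: disjoint_union_def A_def B_def)
  moreover have "finite A" "finite B" using fin by (auto simp: A_def B_def)
  ultimately have "card (parcs (graph_join G H)) = card (parcs (disjoint_union G H)) + card (A \<union> B)"
    by (simp add: card_Un_disjoint)
  also have "card (A \<union> B) = card A + card B"
    using \<open>finite A\<close> \<open>finite B\<close> by (intro card_Un_disjoint) (auto simp: A_def B_def)
  finally show ?thesis
    using fin by (simp add: card_parcs_disjoint_union card_cartesian_product card_image A_def B_def)
qed

lemma card_parcs_complete_graph: "card (parcs (complete_graph m)) = m * (m - 1)"
proof -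
  have "parcs (complete_graph m) = {..<m} \<times> {..<m} - (\<lambda>x. (x, x)) ` {..<m}"
    by (auto simp: complete_graph_def)
  then have "card (parcs (complete_graph m)) = m * m - m"
    by (simp add: card_Diff_subset card_image inj_on_def image_subset_iff)
  then show ?thesis by (simp add: diff_mult_distrib2)
qed

lemma parcs_copies_complete_1: "parcs (copies m (complete_graph 1)) = {}"
  by (auto simp: copies_def complete_graph_def)

lemma card_parcs_extremal_graph:
  "card (parcs (extremal_graph b d n)) =
    d * (d - 1) + (n - (b + 1) * d) * (n - (b + 1) * d - 1)
      + 2 * (d * (n - (b + 1) * d + b * d))"
proof -
  have pg: "pair_graph (disjoint_union (complete_graph (n - (b + 1) * d)) (copies (b * d) (complete_graph 1)))"
    by (intro pair_graph_disjoint_union pair_graph_copies pair_graph_complete_graph)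
  have "finite (parcs (complete_graph k))" for k
    using pair_graph_complete_graph[of k] by (auto simp: pair_graph_iff intro: finite_subset)
  then have "card (parcs (disjoint_union (complete_graph (n - (b + 1) * d))
      (copies (b * d) (complete_graph 1)))) = (n - (b + 1) * d) * (n - (b + 1) * d - 1)"
    by (subst card_parcs_disjoint_union) (simp_all only: card_parcs_complete_graph
        parcs_copies_complete_1 finite.emptyI card.empty add_0_right)
  moreover have "card (pverts (complete_graph d)) = d"
    "card (pverts (disjoint_union (complete_graph (n - (b + 1) * d))
      (copies (b * d) (complete_graph 1)))) = n - (b + 1) * d + b * d"
    by (simp_all add: complete_graph_def disjoint_union_def copies_def card_Plus)
  ultimately show ?thesis
    unfolding extremal_graph_def card_parcs_graph_join[OF pair_graph_complete_graph pg]
      card_parcs_complete_graph by simp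
qed

text \<open>The bounds on \<open>k\<close> and \<open>d\<close> make the truncated subtractions of
  the natural-number formula exact.\<close>

lemma int_card_parcs_extremal_graph:
  assumes "k = int n - (int b + 1) * int d" "k \<ge> 1" "d \<ge> 1"
  shows "int (card (parcs (extremal_graph b d n))) =
    int d * (int d - 1) + k * (k - 1) + 2 * int d * (int n - int d)"
proof -
  define K where "K = n - (b + 1) * d"
  have "int ((b + 1) * d) \<le> int n" using assms(1,2) by (simp add: algebra_simps)
  then have "(b + 1) * d \<le> n" by linarith
  then have K: "int K = k" using assms(1) by (simp add: K_def of_nat_diff algebra_simps)
  have "int (K - 1) = k - 1" using K assms(2) by linarith
  moreover have "int (d - 1) = int d - 1" using assms(3) by simp
  moreover have "k + int b * int d = int n - int d" using assms(1) by (simp add: algebra_simps)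
  ultimately show ?thesis
    unfolding card_parcs_extremal_graph K_def[symmetric] of_nat_add of_nat_mult K by simp
qed

section \<open>Degrees and the arcs permitted by a separator\<close>

lemma out_degree_eq_deg: "out_degree (with_proj G) v = deg (parcs G) v"
proof -
  have "out_arcs (with_proj G) v = Pair v ` {w. (v, w) \<in> parcs G}"
    by (auto simp: out_arcs_def)
  then show ?thesis by (simp add: out_degree_def deg_def card_image inj_on_def)
qed

text \<open>
  All arcs, loops included, that a graph on \<open>V\<close> may have if the members of \<open>P\<close> are unions of
  components after deleting \<open>S\<close>; the loops keep the cardinality free of correction terms.
\<close>

definition full_arcs :: "'a set \<Rightarrow> 'a set \<Rightarrow> 'a set set \<Rightarrow> ('a \<times> 'a) set" where
  "full_arcs V S P = S \<times> V \<union> (V - S) \<times> S \<union> (\<Union>C\<in>P. C \<times> C)"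

lemma card_full_arcs:
  assumes "finite V" "S \<subseteq> V" "\<Union>P = V - S" "\<And>C D. C \<in> P \<Longrightarrow> D \<in> P \<Longrightarrow> C \<inter> D \<noteq> {} \<Longrightarrow> C = D"
  shows "card (full_arcs V S P) =
    card S * card V + (card V - card S) * card S + (\<Sum>C\<in>P. (card C)\<^sup>2)"
proof -
  have PW: "C \<subseteq> V - S" if "C \<in> P" for C using that assms(3) by blast
  have finP: "finite P" using assms(1,3) by (intro finite_UnionD) simp
  have finC: "finite C" if "C \<in> P" for C using PW[OF that] assms(1) finite_subset by blast
  have fin: "finite S" "finite (V - S)" using assms(1,2) finite_subset by auto
  have "card (\<Union>C\<in>P. C \<times> C) = (\<Sum>C\<in>P. card (C \<times> C))"
    using finP finC assms(4) by (intro card_UN_disjoint) blast+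
  also have "\<dots> = (\<Sum>C\<in>P. (card C)\<^sup>2)" by (simp add: card_cartesian_product power2_eq_square)
  finally have 1: "card (\<Union>C\<in>P. C \<times> C) = (\<Sum>C\<in>P. (card C)\<^sup>2)" .
  have "finite (\<Union>C\<in>P. C \<times> C)" using finP finC by blast
  moreover have "(S \<times> V \<union> (V - S) \<times> S) \<inter> (\<Union>C\<in>P. C \<times> C) = {}" using PW by blast
  ultimately have "card (S \<times> V \<union> (V - S) \<times> S \<union> (\<Union>C\<in>P. C \<times> C)) =
      card (S \<times> V \<union> (V - S) \<times> S) + card (\<Union>C\<in>P. C \<times> C)"
    using fin assms(1) by (intro card_Un_disjoint) auto
  also have "card (S \<times> V \<union> (V - S) \<times> S) = card (S \<times> V) + card ((V - S) \<times> S)"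
    using fin assms(1) by (intro card_Un_disjoint) auto
  finally show ?thesis using 1 assms(2) fin by (simp add: full_arcs_def card_cartesian_product card_Diff_subset)
qed

lemma parcs_subset_full_arcs:
  assumes "pair_graph G"
  shows "parcs G \<subseteq> full_arcs (pverts G) S (comps (parcs G) (pverts G - S))"
proof -
  have symE: "sym (parcs G)" and finV: "finite (pverts G)"
    and wf: "\<And>x y. (x, y) \<in> parcs G \<Longrightarrow> x \<in> pverts G \<and> y \<in> pverts G \<and> x \<noteq> y"
    using assms by (auto simp: pair_graph_iff irrefl_def)
  have "\<exists>C\<in>comps (parcs G) (pverts G - S). x \<in> C \<and> y \<in> C"
    if "(x, y) \<in> parcs G" "x \<notin> S" "y \<notin> S" for x y
  proof -
    have xy: "x \<in> pverts G - S" "y \<in> pverts G - S" using that wf by auto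
    then obtain C where C: "C \<in> comps (parcs G) (pverts G - S)" "x \<in> C"
      using Union_comps[OF symE, of "pverts G - S"] finV by auto
    then have "y \<in> C" using comps_imp_detached[OF C(1)] xy that unfolding detached_def by blast
    then show ?thesis using C by blast
  qed
  then show ?thesis using wf unfolding full_arcs_def by fastforce
qed

lemma sum_card_comps:
  assumes "pair_graph G" "S \<subseteq> pverts G"
  shows "(\<Sum>C\<in>comps (parcs G) (pverts G - S). int (card C)) = int (card (pverts G)) - int (card S)"
proof -
  have "sym (parcs G)" and fin: "finite (pverts G)" using assms(1) by (auto simp: pair_graph_iff)
  from sum_comps[OF this(1), of "pverts G - S" "\<lambda>_. 1::nat"]
  have "card (pverts G - S) = (\<Sum>C\<in>comps (parcs G) (pverts G - S). card C)"
    using fin by (simp flip: card_eq_sum)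
  moreover have "int (card (pverts G - S)) = int (card (pverts G)) - int (card S)"
    using card_mono[OF fin assms(2)] finite_subset[OF assms(2) fin] assms(2)
    by (simp add: card_Diff_subset of_nat_diff)
  ultimately show ?thesis by simp
qed

lemma card_full_arcs_comps:
  assumes "pair_graph G" "S \<subseteq> pverts G"
  defines "n \<equiv> int (card (pverts G))" and "s \<equiv> int (card S)"
  shows "int (card (full_arcs (pverts G) S (comps (parcs G) (pverts G - S)))) =
    s * n + s * (n - s) + (\<Sum>C\<in>comps (parcs G) (pverts G - S). (int (card C))\<^sup>2)"
proof -
  have "sym (parcs G)" and fin: "finite (pverts G)" using assms(1) by (auto simp: pair_graph_iff)
  then have U: "\<Union> (comps (parcs G) (pverts G - S)) = pverts G - S" by (simp add: Union_comps)
  have "int (card (pverts G) - card S) = n - s"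
    using card_mono[OF fin assms(2)] by (simp add: n_def s_def of_nat_diff)
  then show ?thesis
    using card_full_arcs[OF fin assms(2) U comps_disjoint] by (simp add: n_def s_def mult.commute)
qed

lemma parcs_Un_loops_subset:
  assumes "pair_graph G" "S \<subseteq> pverts G"
  shows "parcs G \<union> (\<lambda>x. (x, x)) ` pverts G \<subseteq> full_arcs (pverts G) S (comps (parcs G) (pverts G - S))"
proof -
  have "\<Union> (comps (parcs G) (pverts G - S)) = pverts G - S"
    using assms(1) by (simp add: Union_comps pair_graph_iff)
  then have "(\<lambda>x. (x, x)) ` pverts G \<subseteq> full_arcs (pverts G) S (comps (parcs G) (pverts G - S))"
    by (auto simp: full_arcs_def)
  then show ?thesis using parcs_subset_full_arcs[OF assms(1), of S] by blast
qed

lemma card_parcs_Un_loops: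
  assumes "pair_graph G"
  shows "card (parcs G \<union> (\<lambda>x. (x, x)) ` pverts G) = card (parcs G) + card (pverts G)"
proof -
  have "finite (pverts G)" "parcs G \<subseteq> pverts G \<times> pverts G" "irrefl (parcs G)"
    using assms by (auto simp: pair_graph_iff)
  moreover from this have "finite (parcs G)" using finite_subset by blast
  ultimately have "card (parcs G \<union> (\<lambda>x. (x, x)) ` pverts G) =
      card (parcs G) + card ((\<lambda>x. (x, x)) ` pverts G)"
    by (intro card_Un_disjoint) (auto simp: irrefl_def)
  then show ?thesis by (simp add: card_image inj_on_def)
qed

lemma finite_full_arcs_comps:
  assumes "pair_graph G" "S \<subseteq> pverts G"
  shows "finite (full_arcs (pverts G) S (comps (parcs G) (pverts G - S)))"
proof -
  have "full_arcs (pverts G) S (comps (parcs G) (pverts G - S)) \<subseteq> pverts G \<times> pverts G"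
    using assms(2) unfolding full_arcs_def by (auto dest: comps_subset)
  moreover have "finite (pverts G)" using assms(1) by (simp add: pair_graph_iff)
  ultimately show ?thesis using finite_subset by blast
qed

lemma card_parcs_le_full_arcs:
  assumes "pair_graph G" "S \<subseteq> pverts G"
  shows "card (parcs G) + card (pverts G) \<le>
    card (full_arcs (pverts G) S (comps (parcs G) (pverts G - S)))"
  unfolding card_parcs_Un_loops[OF assms(1), symmetric]
  by (rule card_mono[OF finite_full_arcs_comps[OF assms] parcs_Un_loops_subset[OF assms]])

text \<open>Equal cardinalities leave no permitted arc missing, so the graph is determined by
  \<open>S\<close> and the components.\<close>

lemma mem_parcs_full_arcs:
  assumes "pair_graph G" "S \<subseteq> pverts G"
    and "card (parcs G) + card (pverts G) =
      card (full_arcs (pverts G) S (comps (parcs G) (pverts G - S)))"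
    and "x \<in> pverts G" "y \<in> pverts G"
  shows "(x, y) \<in> parcs G \<longleftrightarrow>
    x \<noteq> y \<and> (x, y) \<in> full_arcs (pverts G) S (comps (parcs G) (pverts G - S))"
proof -
  have "parcs G \<union> (\<lambda>x. (x, x)) ` pverts G = full_arcs (pverts G) S (comps (parcs G) (pverts G - S))"
    using card_subset_eq[OF finite_full_arcs_comps[OF assms(1,2)] parcs_Un_loops_subset[OF assms(1,2)]]
      assms(3) card_parcs_Un_loops[OF assms(1)] by simp
  moreover have "irrefl (parcs G)" using assms(1) by (simp add: pair_graph_iff)
  ultimately show ?thesis by (auto simp: irrefl_def)
qed

text \<open>All neighbours of a vertex of \<open>C\<close> lie in \<open>S\<close> or among the
  other vertices of \<open>C\<close>.\<close>

lemma card_comp_ge: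
  assumes "pair_graph G" "S \<subseteq> pverts G" "\<And>v. v \<in> pverts G \<Longrightarrow> d \<le> deg (parcs G) v"
    and C: "C \<in> comps (parcs G) (pverts G - S)"
  shows "d < card C + card S"
proof -
  have fin: "finite (pverts G)" and E: "parcs G \<subseteq> pverts G \<times> pverts G" and irr: "irrefl (parcs G)"
    using assms(1) by (auto simp: pair_graph_iff)
  have finS: "finite S" and finC: "finite C"
    using fin assms(2) comps_subset[OF C] finite_subset by blast+
  obtain v where v: "v \<in> C" using comps_nonempty[OF C] by blast
  have "{w. (v, w) \<in> parcs G} \<subseteq> (C - {v}) \<union> S"
  proof
    fix w assume w: "w \<in> {w. (v, w) \<in> parcs G}"
    then have "w \<noteq> v" "w \<in> pverts G" using irr E by (auto simp: irrefl_def)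
    then show "w \<in> (C - {v}) \<union> S"
      using comps_imp_detached[OF C] w v unfolding detached_def by blast
  qed
  then have "deg (parcs G) v \<le> card ((C - {v}) \<union> S)"
    unfolding deg_def using finC finS by (intro card_mono) auto
  also have "\<dots> \<le> card (C - {v}) + card S" by (rule card_Un_le)
  also have "card (C - {v}) < card C" using v finC by (rule card_Diff1_less[rotated])
  finally show ?thesis using assms(3)[of v] v comps_subset[OF C] by fastforce
qed

text \<open>The bridge from walks to detached sets: a detached set absorbs everything reachable from
  one of its vertices.\<close>

lemma comps_connected:
  assumes "pair_graph G" "connected (with_proj G)"
  shows "comps (parcs G) (pverts G) = {pverts G}"
proof -
  have wf: "x \<in> pverts G \<and> y \<in> pverts G" if "(x, y) \<in> parcs G" for x y
    using assms(1) that by (auto simp: pair_graph_iff)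
  have wfG: "wf_digraph (with_proj G)" using wf by unfold_locales auto
  have "symmetric (with_proj G)"
    using assms(1) by (auto simp: symmetric_def pair_graph_iff)
  then have strong: "strongly_connected (with_proj G)"
    using assms(2) by (rule wf_digraph.symmetric_connected_imp_strongly_connected[OF wfG])
  have whole: "D = pverts G" if D: "detached (parcs G) (pverts G) D" "D \<noteq> {}" for D
  proof -
    obtain x where x: "x \<in> D" using D(2) by blast
    have Dsub: "D \<subseteq> pverts G" using D(1) by (simp add: detached_def)
    have "y \<in> D" if "x \<rightarrow>\<^sup>*\<^bsub>with_proj G\<^esub> y" for y
      using that
    proof (induction rule: wf_digraph.reachable_induct[OF wfG, consumes 1, case_names base step])
      case base show ?case by (rule x)
    next
      case (step y z)
      have "(y, z) \<in> parcs G" using step by simp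
      then show ?case using D(1) step wf unfolding detached_def by blast
    qed
    moreover have "x \<rightarrow>\<^sup>*\<^bsub>with_proj G\<^esub> y" if "y \<in> pverts G" for y
      using strong x Dsub that by (auto simp: strongly_connected_def)
    ultimately show ?thesis using Dsub by blast
  qed
  have "pverts G \<noteq> {}" using strong by (auto simp: strongly_connected_def)
  moreover have "detached (parcs G) (pverts G) (pverts G)" by (simp add: detached_def)
  ultimately show ?thesis using whole unfolding comps_def by blast
qed

section \<open>The extremal graph\<close>

text \<open>\<open>projr\<close> is unspecified on left summands, but the first two disjuncts have
  already decided those cases.\<close>

lemma mem_parcs_extremal_graph:
  "(x, y) \<in> parcs (extremal_graph b d n) \<longleftrightarrow>
    x \<in> pverts (extremal_graph b d n) \<and> y \<in> pverts (extremal_graph b d n) \<and> x \<noteq> y \<and>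
    (isl x \<or> isl y \<or> isl (projr x) \<and> isl (projr y))"
  by (cases x; cases y; cases "projr x"; cases "projr y")
    (auto simp: extremal_graph_def graph_join_def disjoint_union_def copies_def complete_graph_def)

lemma pverts_extremal_graph:
  "pverts (extremal_graph b d n) = {..<d} <+> ({..<n - (b + 1) * d} <+> {..<b * d} \<times> {0})"
  by (auto simp: extremal_graph_def graph_join_def disjoint_union_def copies_def complete_graph_def)

text \<open>Adjacency of distinct vertices depends only on the parts containing them, so arbitrary
  bijections between corresponding parts combine to an isomorphism.\<close>

lemma graph_iso_extremal_graph:
  assumes "pair_graph G" "pverts G = S \<union> L \<union> U" "S \<inter> L = {}" "S \<inter> U = {}" "L \<inter> U = {}"
    and card: "card S = d" "card L = n - (b + 1) * d" "card U = b * d"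
    and arcs: "\<And>x y. x \<in> pverts G \<Longrightarrow> y \<in> pverts G \<Longrightarrow>
      (x, y) \<in> parcs G \<longleftrightarrow> x \<noteq> y \<and> (x \<in> S \<or> y \<in> S \<or> x \<in> L \<and> y \<in> L)"
  shows "graph_iso G (extremal_graph b d n)"
proof -
  let ?H = "extremal_graph b d n"
  have "finite (pverts G)" using assms(1) by (simp add: pair_graph_iff)
  then have fin: "finite S" "finite L" "finite U" using assms(2) by auto
  obtain gS where gS: "bij_betw gS S {..<d}"
    using ex_bij_betw_finite_nat[OF fin(1)] card(1) by (auto simp: atLeast0LessThan)
  obtain gL where gL: "bij_betw gL L {..<n - (b + 1) * d}"
    using ex_bij_betw_finite_nat[OF fin(2)] card(2) by (auto simp: atLeast0LessThan)
  have "finite ({..<b * d} \<times> {0::nat})" "card U = card ({..<b * d} \<times> {0::nat})"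
    using card(3) by simp_all
  from finite_same_card_bij[OF fin(3) this]
  obtain gU where gU: "bij_betw gU U ({..<b * d} \<times> {0::nat})" by blast
  define f where "f x = (if x \<in> S then Inl (gS x) else if x \<in> L then Inr (Inl (gL x)) else Inr (Inr (gU x)))" for x
  have fS: "f x = Inl (gS x)" if "x \<in> S" for x using that by (simp add: f_def)
  have fL: "f x = Inr (Inl (gL x))" if "x \<in> L" for x using that assms(3) by (auto simp: f_def)
  have fU: "f x = Inr (Inr (gU x))" if "x \<in> U" for x using that assms(4,5) by (auto simp: f_def)
  have img: "gS ` S = {..<d}" "gL ` L = {..<n - (b + 1) * d}" "gU ` U = {..<b * d} \<times> {0}"
    using gS gL gU by (simp_all add: bij_betw_def)
  have inj: "inj_on gS S" "inj_on gL L" "inj_on gU U"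
    using gS gL gU by (simp_all add: bij_betw_def)
  have "f ` pverts G = f ` S \<union> f ` L \<union> f ` U" using assms(2) by auto
  also have "f ` S = Inl ` gS ` S" using fS by (auto simp: image_image)
  also have "f ` L = Inr ` Inl ` gL ` L" using fL by (auto simp: image_image)
  also have "f ` U = Inr ` Inr ` gU ` U" using fU by (auto simp: image_image)
  finally have im: "f ` pverts G = pverts ?H"
    unfolding img pverts_extremal_graph by (auto simp: Plus_def)
  moreover have "inj_on f (pverts G)"
  proof (rule inj_onI)
    fix x y assume "x \<in> pverts G" "y \<in> pverts G" "f x = f y"
    then show "x = y"
      using inj unfolding assms(2) by (auto simp: fS fL fU dest: inj_onD)
  qed
  ultimately have bij: "bij_betw f (pverts G) (pverts ?H)" by (simp add: bij_betw_def)
  have arc: "(f x, f y) \<in> parcs ?H \<longleftrightarrow> (x, y) \<in> parcs G"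
    if x: "x \<in> pverts G" and y: "y \<in> pverts G" for x y
  proof -
    have "f x \<in> pverts ?H" "f y \<in> pverts ?H" using im x y by auto
    moreover have "f x = f y \<longleftrightarrow> x = y" using bij x y by (auto simp: bij_betw_def dest: inj_onD)
    moreover have "isl (f z) \<longleftrightarrow> z \<in> S" for z by (simp add: f_def)
    moreover have "isl (projr (f z)) \<longleftrightarrow> z \<in> L" if "z \<notin> S" for z using that by (simp add: f_def)
    ultimately show ?thesis unfolding arcs[OF x y] mem_parcs_extremal_graph by blast
  qed
  have "parcs ?H = map_prod f f ` parcs G"
  proof (intro equalityI subsetI)
    fix a assume a: "a \<in> parcs ?H"
    then have "fst a \<in> f ` pverts G" "snd a \<in> f ` pverts G"
      using pair_graph_extremal_graph[of b d n] unfolding im pair_graph_iff by auto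
    then obtain x y where "x \<in> pverts G" "y \<in> pverts G" "a = (f x, f y)"
      by (metis imageE prod.collapse)
    then show "a \<in> map_prod f f ` parcs G" using a arc by force
  next
    fix a assume "a \<in> map_prod f f ` parcs G"
    then obtain x y where "(x, y) \<in> parcs G" "a = (f x, f y)" by auto
    moreover from this have "x \<in> pverts G" "y \<in> pverts G"
      using assms(1) by (auto simp: pair_graph_iff)
    ultimately show "a \<in> parcs ?H" using arc by simp
  qed
  then show ?thesis using bij graph_iso_iff[OF assms(1)] by blast
qed

section \<open>From a missing factor to the extremal graph\<close>

lemma has_H_factorI:
  assumes "pair_graph G" "b \<ge> 1" "F \<subseteq> parcs G" "sym F"
    and deg: "\<And>v. v \<in> pverts G \<Longrightarrow> odd (deg F v) \<and> deg F v \<le> b - 1 \<or> deg F v = b"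
  shows "has_H_factor b G"
proof -
  let ?F = "\<lparr>pverts = pverts G, parcs = F\<rparr>"
  have F: "pair_graph ?F"
    using assms(1,3,4) by (auto simp: pair_graph_iff irrefl_def)
  have "spanning (with_proj ?F) (with_proj G)"
    using assms(1,3) F pair_graph.axioms
    by (auto simp: spanning_def subgraph_def compatible_def pair_graph_iff intro!: wf_digraph.intro)
  moreover have "out_degree (with_proj ?F) v \<in> {k \<in> {1..b - 1}. odd k} \<union> {b}" if "v \<in> pverts G" for v
    using deg[OF that] by (auto simp: out_degree_eq_deg Suc_le_eq intro: odd_pos)
  ultimately show ?thesis using F unfolding has_H_factor_def is_H_factor_def by blast
qed

text \<open>A connected graph of even order has no odd component, so the violating set cannot be
  empty. Parity is then forgotten, because the edge count uses only the number of
  components.\<close>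

lemma no_H_factor_separator:
  assumes "pair_graph G" "connected (with_proj G)" "even (card (pverts G))" "b \<ge> 2" "even b"
    and no: "\<not> has_H_factor b G"
  obtains S where "S \<subseteq> pverts G" "S \<noteq> {}" "b * card S < card (comps (parcs G) (pverts G - S))"
proof -
  let ?oc = "\<lambda>S. odd_comps (parcs G) (\<lambda>_. b - 1) (pverts G - S)"
  have symE: "sym (parcs G)" and fin: "finite (pverts G)" using assms(1) by (auto simp: pair_graph_iff)
  have "\<exists>S\<subseteq>pverts G. (\<Sum>v\<in>S. Suc (b - 1)) < card (?oc S)"
  proof (rule ccontr)
    assume "\<not> ?thesis"
    then have cond: "card (?oc T) \<le> (\<Sum>v\<in>T. Suc (b - 1))" if "T \<subseteq> pverts G" for T
      using that not_less by blast
    have "odd (b - 1)" using assms(4,5) by simp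
    then obtain F where F: "F \<subseteq> parcs G" "sym F"
      "\<And>v. v \<in> pverts G \<Longrightarrow> odd (deg F v) \<and> deg F v \<le> b - 1 \<or> deg F v = Suc (b - 1)"
      using odd_or_succ_factor_exists[OF symE fin cond] by metis
    have "has_H_factor b G"
      using F assms(4) by (intro has_H_factorI[OF assms(1), of b F]) auto
    then show False using no by blast
  qed
  then obtain S where S: "S \<subseteq> pverts G" "b * card S < card (?oc S)"
    using assms(4) by (auto simp: mult.commute)
  have "?oc {} = {}"
    using comps_connected[OF assms(1,2)] assms(3) by (auto simp: odd_comps_def)
  then have "S \<noteq> {}" using S(2) by auto
  moreover have "card (?oc S) \<le> card (comps (parcs G) (pverts G - S))"
    using fin by (intro card_mono) (auto simp: odd_comps_def finite_comps)
  ultimately show ?thesis using that S by simp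
qed

lemma graph_iso_extremal_graph_full_arcs:
  assumes pg: "pair_graph G" and S: "S \<subseteq> pverts G" "card S = d"
    and eq: "card (parcs G) + card (pverts G) =
      card (full_arcs (pverts G) S (comps (parcs G) (pverts G - S)))"
    and L: "L \<in> comps (parcs G) (pverts G - S)" "card L = card (pverts G) - (b + 1) * d"
    and n: "(b + 1) * d \<le> card (pverts G)"
    and single: "\<And>C. C \<in> comps (parcs G) (pverts G - S) \<Longrightarrow> C \<noteq> L \<Longrightarrow> card C = 1"
  shows "graph_iso G (extremal_graph b d (card (pverts G)))"
proof (rule graph_iso_extremal_graph[OF pg])
  have LV: "L \<subseteq> pverts G - S" using comps_subset[OF L(1)] .
  have fin: "finite (pverts G)" using pg by (simp add: pair_graph_iff)
  then have "finite S" "finite L" using S(1) LV finite_subset by blast+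
  show "pverts G = S \<union> L \<union> (pverts G - S - L)" using S(1) LV by auto
  show "S \<inter> L = {}" "S \<inter> (pverts G - S - L) = {}" "L \<inter> (pverts G - S - L) = {}" using LV by auto
  show "card S = d" "card L = card (pverts G) - (b + 1) * d" by fact+
  have "card (pverts G - S - L) = card (pverts G) - d - card L"
    using LV \<open>finite S\<close> \<open>finite L\<close> S by (simp add: card_Diff_subset)
  then show "card (pverts G - S - L) = b * d" using L(2) n by (simp add: algebra_simps)
  fix x y assume xy: "x \<in> pverts G" "y \<in> pverts G"
  have "C = L" if "C \<in> comps (parcs G) (pverts G - S)" "x \<in> C" "y \<in> C" "x \<noteq> y" for C
    using single[OF that(1)] that card_1_singletonE by (metis singletonD)
  then show "(x, y) \<in> parcs G \<longleftrightarrow> x \<noteq> y \<and> (x \<in> S \<or> y \<in> S \<or> x \<in> L \<and> y \<in> L)"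
    unfolding mem_parcs_full_arcs[OF pg S(1) eq xy] using xy L(1) by (auto simp: full_arcs_def)
qed

theorem theorem1p1:
  fixes G :: "'a pair_pre_digraph" and b n \<delta> :: nat
  assumes "b \<ge> 2" and "even b"
    and "pair_graph G"
    and "Digraph_Component.connected (with_proj G)"
    and "graph_order G = n" and "even n"
    and "min_degree G = \<delta>" and "\<delta> \<ge> 1"
    and "real n \<ge> max
           ((real b ^ 2 * real \<delta> + 2 * real b * real \<delta> - real \<delta> - 1) / (real b - 1))
           ((real b ^ 2 * real \<delta> ^ 2 + (4 * real b ^ 2 + 5 * real b) * real \<delta>
              + real b ^ 2 + 4 * real b + 1) / (6 * real b))"
    and "graph_size G \<ge> graph_size (extremal_graph b \<delta> n)"
  shows "has_H_factor b G \<or> graph_iso G (extremal_graph b \<delta> n)"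
proof (cases "has_H_factor b G")
  case False
  note pg = assms(3)
  let ?V = "pverts G" and ?E = "parcs G"
  have finV: "finite ?V" using pg by (simp add: pair_graph_iff)
  have cardV: "card ?V = n" using assms(5) by (simp add: graph_order_def)
  have min_deg: "\<delta> \<le> deg ?E v" if "v \<in> ?V" for v
    using assms(7) that finV unfolding min_degree_def out_degree_eq_deg[symmetric] by auto

  have "(real b ^ 2 * real \<delta> + 2 * real b * real \<delta> - real \<delta> - 1) / (real b - 1) \<le> real n"
    using assms(9) by simp
  then have "real b ^ 2 * real \<delta> + 2 * real b * real \<delta> - real \<delta> - 1 \<le> (real b - 1) * real n"
    using assms(1) by (simp add: pos_divide_le_eq mult.commute)
  then have "real_of_int ((int b)\<^sup>2 * int \<delta> + 2 * int b * int \<delta> - int \<delta> - 1) \<le>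
      real_of_int ((int b - 1) * int n)" by simp
  then have hyp: "(int b)\<^sup>2 * int \<delta> + 2 * int b * int \<delta> - int \<delta> - 1 \<le> (int b - 1) * int n"
    by (simp only: of_int_le_iff)
  have b2: "int b \<ge> 2" and d1: "int \<delta> \<ge> 1" using assms(1,8) by simp_all
  note bn = order_lower_bound_mult[OF b2 d1 hyp]
  note n_large = order_lower_bound[OF b2 d1 bn]
  define k where "k = int n - (int b + 1) * int \<delta>"
  \<comment> \<open>\<open>k\<close> is the order of the large clique. In the equality case the
    surplus is k - 1, which must be positive to single out one component.\<close>
  have k2: "k \<ge> 2 * int \<delta>" using n_large by (simp add: k_def algebra_simps)
  have "int ((b + 1) * \<delta>) \<le> int n" using k2 by (simp add: k_def algebra_simps)
  then have le_n: "(b + 1) * \<delta> \<le> n" by linarith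

  have "card (parcs (extremal_graph b \<delta> n)) \<le> card ?E"
    using card_parcs_eq_twice_size[OF pg] card_parcs_eq_twice_size[OF pair_graph_extremal_graph[of b \<delta> n]]
      assms(10) by simp
  then have many: "int \<delta> * (int \<delta> - 1) + k * (k - 1) + 2 * int \<delta> * (int n - int \<delta>) \<le> int (card ?E)"
    using int_card_parcs_extremal_graph[OF k_def _ assms(8)] k2 d1 by linarith

  obtain S where S: "S \<subseteq> ?V" "S \<noteq> {}" "b * card S < card (comps ?E (?V - S))"
    using no_H_factor_separator[OF pg assms(4) _ assms(1,2) False] assms(6) cardV by auto
  define s where "s = int (card S)"
  define P where "P = comps ?E (?V - S)"
  have "finite S" using S(1) finV finite_subset by blast
  then have s1: "s \<ge> 1" using S(2) by (simp add: s_def Suc_le_eq card_gt_0_iff)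
  have finP: "finite P" using finV by (simp add: P_def finite_comps)
  have "int (b * card S) < int (card P)" using S(3) by (simp only: of_nat_less_iff P_def)
  then have cardP: "int b * s + 1 \<le> int (card P)" by (simp add: s_def)
  have sumP: "(\<Sum>C\<in>P. int (card C)) = int n - s"
    using sum_card_comps[OF pg S(1)] by (simp add: P_def s_def cardV)
  note full = card_full_arcs_comps[OF pg S(1), folded P_def s_def, unfolded cardV]
  note le_full = card_parcs_le_full_arcs[OF pg S(1), folded P_def, unfolded cardV]
  have count: "int (card ?E) + int n \<le> s * int n + s * (int n - s) + (\<Sum>C\<in>P. (int (card C))\<^sup>2)"
    using full le_full by linarith
  have size1: "1 \<le> int (card C)" if "C \<in> P" for C
  proof -
    have C: "C \<in> comps ?E (?V - S)" using that by (simp add: P_def)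
    have "finite C" using finite_subset[OF comps_subset[OF C]] finV by simp
    moreover have "C \<noteq> {}" using C by (rule comps_nonempty)
    ultimately show ?thesis by (simp add: Suc_le_eq card_gt_0_iff)
  qed
  have size: "int \<delta> + 1 - s \<le> int (card C)" if "C \<in> P" for C
    using card_comp_ge[OF pg S(1) min_deg that[unfolded P_def]] by (simp add: s_def)

  \<comment> \<open>The minimum degree gives the better bound on component orders while s <
    \<delta>; from s = \<delta> on, the trivial bound 1 is at least as good.\<close>
  consider "s < int \<delta>" | "s > int \<delta>" | "s = int \<delta>" by linarith
  then show ?thesis
  proof cases
    case 1
    have "1 \<le> int \<delta> + 1 - s" using 1 by simp
    note sq = sum_squares_le[where x = "\<lambda>C. int (card C)", OF finP size this cardP, unfolded sumP]
    note low = card_mult_le_sum[where x = "\<lambda>C. int (card C)", OF size \<open>1 \<le> int \<delta> + 1 - s\<close> cardP, unfolded sumP]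
    have "s * int n + s * (int n - s) + (int \<delta> + 1 - s) * (int n - s) +
        (int \<delta> + 1 - s + (int n - s - (int b * s + 1) * (int \<delta> + 1 - s))) *
        (int n - s - (int b * s + 1) * (int \<delta> + 1 - s)) - int n
      < int \<delta> * (int \<delta> - 1) + k * (k - 1) + 2 * int \<delta> * (int n - int \<delta>)"
      using low by (intro small_separator_count[OF b2 s1 1 n_large refl refl _ k_def]) (simp add: mult.commute)
    then show ?thesis using sq count many by linarith
  next
    case 2
    note sq = sum_squares_le[where x = "\<lambda>C. int (card C)", OF finP size1 order_refl cardP, unfolded sumP mult_1 mult_1_right]
    note low = card_mult_le_sum[where x = "\<lambda>C. int (card C)", OF size1 order_refl cardP, unfolded sumP]
    have "s * int n + s * (int n - s) + (int n - s) +
        (1 + (int n - s - (int b * s + 1))) * (int n - s - (int b * s + 1)) - int n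
      < int \<delta> * (int \<delta> - 1) + k * (k - 1) + 2 * int \<delta> * (int n - int \<delta>)"
      using low by (intro large_separator_count[OF b2 d1 2 bn refl _ k_def]) simp
    then show ?thesis using sq count many by linarith
  next
    case 3
    note sq = sum_squares_le[where x = "\<lambda>C. int (card C)", OF finP size1 order_refl cardP, unfolded sumP mult_1 mult_1_right]
    have Z: "int n - s - (int b * s + 1) = k - 1" by (simp add: 3 k_def algebra_simps)
    \<comment> \<open>For s = \<delta> the upper estimate is exactly the arc count of the extremal
      graph plus \<open>n\<close> loops. The squeeze makes the square bound and the inclusion in
      \<open>full_arcs\<close> tight at once: the former fixes the component orders, the latter all
      adjacencies.\<close>
    have "int \<delta> * (int \<delta> - 1) + k * (k - 1) + 2 * int \<delta> * (int n - int \<delta>) + int n =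
        s * int n + s * (int n - s) + (int n - s + (1 + (k - 1)) * (k - 1))"
      by (simp add: 3 algebra_simps)
    then have sq_eq: "(\<Sum>C\<in>P. (int (card C))\<^sup>2) = int n - s + (1 + (k - 1)) * (k - 1)"
      and "int (card ?E) + int n = int (card (full_arcs ?V S P))"
      using sq[unfolded Z] count many full by linarith+
    then have cardE: "card ?E + card ?V = card (full_arcs ?V S P)" using cardV by linarith
    have "\<exists>L\<in>P. int (card L) = 1 + (k - 1) \<and> (\<forall>C\<in>P - {L}. int (card C) = 1)"
      using sq_eq k2 d1 Z sumP by (intro sum_squares_eqD[OF finP size1 order_refl cardP]) auto
    then obtain L where L: "L \<in> P" "int (card L) = k" "\<And>C. C \<in> P \<Longrightarrow> C \<noteq> L \<Longrightarrow> card C = 1"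
      by auto
    have "card S = \<delta>" using 3 by (simp add: s_def)
    moreover have "int (card L) = int (n - (b + 1) * \<delta>)"
      using L(2) le_n by (simp add: k_def of_nat_diff algebra_simps)
    then have "card L = card ?V - (b + 1) * \<delta>" using cardV by linarith
    ultimately have "graph_iso G (extremal_graph b \<delta> (card ?V))"
      using graph_iso_extremal_graph_full_arcs[OF pg S(1), folded P_def, OF _ cardE L(1) _ _ L(3)]
        le_n cardV by blast
    then have "graph_iso G (extremal_graph b \<delta> n)" by (simp only: cardV)
    then show ?thesis by blast
  qed
qed simp

end
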